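(* Let $R$ be a finite commutative ring with $1$. Then the category of $\mathrm{V}'(R)$-modules is locally Noetherian.
   Context: All rings are commutative with $1$. $\mathrm{V}'(R)$ is the category whose objects are finite-rank free $R$-modules and whose morphisms are all $R$-linear maps. For a category $\mathsf{C}$ and a ring $\mathbf{k}$, a $\mathsf{C}$-module over $\mathbf{k}$ is a functor $M$ from $\mathsf{C}$ to $\mathbf{k}$-modules, with value $M_C$ at an object $C$; morphisms are natural transformations, and submodules are defined pointwise. $M$ is finitely generated if there are finitely many objects $C_1,\dots,C_n$ and elements $x_i\in M_{C_i}$ such that the smallest $\mathsf{C}$-submodule of $M$ containing all $x_i$ is $M$. The category of $\mathsf{C}$-modules over $\mathbf{k}$ is locally Noetherian if every submodule of a finitely generated $\mathsf{C}$-module over $\mathbf{k}$ is finitely generated. The category of $\mathsf{C}$-modules is locally Noetherian if this holds over every Noetherian ring $\mathbf{k}$. *)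

theory Defs
  imports "HOL-Algebra.Ring_Divisibility" "Jordan_Normal_Form.Missing_VectorSpace"
begin

section \<open>Categories and functors\<close>

text \<open>Hom-sets need not be disjoint, so composition, identities and the action of a functor on
  morphisms take the objects involved as explicit arguments:
  \<open>Comp C X Y Z g f\<close> is the composite of \<open>f : X \<rightarrow> Y\<close> with \<open>g : Y \<rightarrow> Z\<close>.\<close>

record ('o, 'a) category =
  Obj :: "'o set"
  Hom :: "'o \<Rightarrow> 'o \<Rightarrow> 'a set"
  Comp :: "'o \<Rightarrow> 'o \<Rightarrow> 'o \<Rightarrow> 'a \<Rightarrow> 'a \<Rightarrow> 'a"
  Ident :: "'o \<Rightarrow> 'a"

locale category =
  fixes C :: "('o, 'a) category"
  assumes Ident_in_Hom: "X \<in> Obj C \<Longrightarrow> Ident C X \<in> Hom C X X"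
    and Comp_in_Hom: "\<lbrakk>X \<in> Obj C; Y \<in> Obj C; Z \<in> Obj C; f \<in> Hom C X Y; g \<in> Hom C Y Z\<rbrakk>
      \<Longrightarrow> Comp C X Y Z g f \<in> Hom C X Z"
    and Comp_Ident_right: "\<lbrakk>X \<in> Obj C; Y \<in> Obj C; f \<in> Hom C X Y\<rbrakk>
      \<Longrightarrow> Comp C X X Y f (Ident C X) = f"
    and Comp_Ident_left: "\<lbrakk>X \<in> Obj C; Y \<in> Obj C; f \<in> Hom C X Y\<rbrakk>
      \<Longrightarrow> Comp C X Y Y (Ident C Y) f = f"
    and Comp_assoc: "\<lbrakk>X \<in> Obj C; Y \<in> Obj C; Z \<in> Obj C; W \<in> Obj C;
        f \<in> Hom C X Y; g \<in> Hom C Y Z; h \<in> Hom C Z W\<rbrakk>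
      \<Longrightarrow> Comp C X Z W h (Comp C X Y Z g f) = Comp C X Y W (Comp C Y Z W h g) f"

lemma (in category) full_subcategory:
  assumes "S \<subseteq> Obj C"
  shows "category (C\<lparr>Obj := S\<rparr>)"
  using assms
  by unfold_locales
    (simp_all add: subset_iff Ident_in_Hom Comp_in_Hom Comp_Ident_right Comp_Ident_left Comp_assoc)

record ('o, 'a, 'p, 'b) cat_functor =
  on_Obj :: "'o \<Rightarrow> 'p"
  on_Hom :: "'o \<Rightarrow> 'o \<Rightarrow> 'a \<Rightarrow> 'b"

locale cat_functor = source: category C + target: category D
  for C :: "('o, 'a) category" and D :: "('p, 'b) category"
    and F :: "('o, 'a, 'p, 'b) cat_functor" +
  assumes on_Obj_closed: "X \<in> Obj C \<Longrightarrow> on_Obj F X \<in> Obj D"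
    and on_Hom_closed: "\<lbrakk>X \<in> Obj C; Y \<in> Obj C; f \<in> Hom C X Y\<rbrakk>
      \<Longrightarrow> on_Hom F X Y f \<in> Hom D (on_Obj F X) (on_Obj F Y)"
    and on_Hom_Ident: "X \<in> Obj C \<Longrightarrow> on_Hom F X X (Ident C X) = Ident D (on_Obj F X)"
    and on_Hom_Comp: "\<lbrakk>X \<in> Obj C; Y \<in> Obj C; Z \<in> Obj C; f \<in> Hom C X Y; g \<in> Hom C Y Z\<rbrakk>
      \<Longrightarrow> on_Hom F X Z (Comp C X Y Z g f) =
          Comp D (on_Obj F X) (on_Obj F Y) (on_Obj F Z) (on_Hom F Y Z g) (on_Hom F X Y f)"


section \<open>Categories of modules over a ring\<close>

text \<open>The objects are the modules whose carrier is a set of elements of the type \<open>'m\<close>.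
  Morphisms are extensional functions, so that two linear maps are equal as soon as they agree on
  the carrier of their source. The ring-multiplication fields of the record type
  \<open>module\<close> are junk; records that differ only there, or only outside the carrier, are distinct
  but isomorphic objects.\<close>

definition module_cat :: "'k ring \<Rightarrow> (('k, 'm) module, 'm \<Rightarrow> 'm) category" where
  "module_cat k =
    \<lparr>Obj = {A. module k A},
     Hom = (\<lambda>A B. module_hom k A B \<inter> extensional (carrier A)),
     Comp = (\<lambda>A B D g f. compose (carrier A) g f),
     Ident = (\<lambda>A. \<lambda>x \<in> carrier A. x)\<rparr>"

definition free_of_finite_rank :: "'r ring \<Rightarrow> ('r, 'm) module \<Rightarrow> bool" where
  "free_of_finite_rank R A \<longleftrightarrow> module R A \<and>
    (\<exists>B. finite B \<and> B \<subseteq> carrier A \<and> module.lin_indpt R A B \<and> module.gen_set R A B)"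

text \<open>The full subcategory of finite-rank free modules. If \<open>R\<close> is finite, every such module is
  finite, so as soon as the type \<open>'m\<close> is infinite every finite-rank free module is
  isomorphic to an object of this category.\<close>

definition V' :: "'r ring \<Rightarrow> (('r, 'm) module, 'm \<Rightarrow> 'm) category" where
  "V' R = (module_cat R)\<lparr>Obj := {A. free_of_finite_rank R A}\<rparr>"

lemma module_hom_comp:
  assumes "f \<in> module_hom k A B" "g \<in> module_hom k B D" "module k A"
  shows "compose (carrier A) g f \<in> module_hom k A D"
proof -
  interpret A: module k A by fact
  show ?thesis
    using assms(1,2) by (auto simp: module_hom_def compose_def Pi_def)
qed

lemma category_module_cat:
  fixes k :: "'k ring"
  shows "category (module_cat k :: (('k, 'm) module, 'm \<Rightarrow> 'm) category)"
proof
  fix X :: "('k, 'm) module" assume "X \<in> Obj (module_cat k)"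
  then interpret module k X by (simp add: module_cat_def)
  show "Ident (module_cat k) X \<in> Hom (module_cat k) X X"
    by (auto simp: module_cat_def module_hom_def)
next
  fix X Y Z :: "('k, 'm) module" and f g
  assume "X \<in> Obj (module_cat k)" "f \<in> Hom (module_cat k) X Y" "g \<in> Hom (module_cat k) Y Z"
  then show "Comp (module_cat k) X Y Z g f \<in> Hom (module_cat k) X Z"
    by (auto simp: module_cat_def intro: module_hom_comp)
next
  fix X Y :: "('k, 'm) module" and f assume f: "f \<in> Hom (module_cat k) X Y"
  then show "Comp (module_cat k) X X Y f (Ident (module_cat k) X) = f"
    by (auto simp: module_cat_def compose_def extensional_def fun_eq_iff)
  from f show "Comp (module_cat k) X Y Y (Ident (module_cat k) Y) f = f"
    by (auto simp: module_cat_def compose_def extensional_def fun_eq_iff module_hom_def)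
next
  fix X Y Z W :: "('k, 'm) module" and f g h
  assume "f \<in> Hom (module_cat k) X Y"
  then show "Comp (module_cat k) X Z W h (Comp (module_cat k) X Y Z g f) =
      Comp (module_cat k) X Y W (Comp (module_cat k) Y Z W h g) f"
    by (auto simp: module_cat_def compose_def fun_eq_iff module_hom_def)
qed

lemma category_V':
  fixes R :: "'r ring"
  shows "category (V' R :: (('r, 'm) module, 'm \<Rightarrow> 'm) category)"
proof -
  have "{A :: ('r, 'm) module. free_of_finite_rank R A} \<subseteq> Obj (module_cat R)"
    by (auto simp: module_cat_def free_of_finite_rank_def)
  then show ?thesis
    unfolding V'_def by (rule category.full_subcategory[OF category_module_cat])
qed


section \<open>Modules over a category\<close>

text \<open>A \<open>C\<close>-module over \<open>k\<close>, with values in the \<open>k\<close>-modules carried by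
  sets of elements of \<open>'v\<close>.\<close>

type_synonym ('o, 'a, 'k, 'v) cmodule = "('o, 'a, ('k, 'v) module, 'v \<Rightarrow> 'v) cat_functor"

definition cmodule ::
  "('o, 'a) category \<Rightarrow> 'k ring \<Rightarrow> ('o, 'a, 'k, 'v) cmodule \<Rightarrow> bool" where
  "cmodule C k M \<longleftrightarrow> cat_functor C (module_cat k) M"

definition csubmodule ::
  "('o, 'a) category \<Rightarrow> 'k ring \<Rightarrow> ('o, 'a, 'k, 'v) cmodule \<Rightarrow> ('o \<Rightarrow> 'v set) \<Rightarrow> bool" where
  "csubmodule C k M N \<longleftrightarrow>
    (\<forall>X \<in> Obj C. Module.submodule (N X) k (on_Obj M X)) \<and>
    (\<forall>X \<in> Obj C. \<forall>Y \<in> Obj C. \<forall>f \<in> Hom C X Y. on_Hom M X Y f ` N X \<subseteq> N Y)"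

text \<open>A submodule \<open>N\<close> of \<open>M\<close>, regarded as a \<open>C\<close>-module in its own right.\<close>

definition sub_cmodule ::
  "('o, 'a, 'k, 'v) cmodule \<Rightarrow> ('o \<Rightarrow> 'v set) \<Rightarrow> ('o, 'a, 'k, 'v) cmodule" where
  "sub_cmodule M N =
    \<lparr>on_Obj = (\<lambda>X. (on_Obj M X)\<lparr>carrier := N X\<rparr>),
     on_Hom = (\<lambda>X Y f. restrict (on_Hom M X Y f) (N X))\<rparr>"

text \<open>A pair \<open>(X, x)\<close> in the set \<open>S\<close> of generators stands for the element \<open>x\<close> of the value
  of \<open>M\<close> at \<open>X\<close>.\<close>

definition generated_csubmodule ::
  "('o, 'a) category \<Rightarrow> 'k ring \<Rightarrow> ('o, 'a, 'k, 'v) cmodule \<Rightarrow> ('o \<times> 'v) set \<Rightarrow> 'o \<Rightarrow> 'v set" where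
  "generated_csubmodule C k M S X =
    \<Inter> {N X | N. csubmodule C k M N \<and> (\<forall>(Y, y) \<in> S. y \<in> N Y)}"

definition fin_generated ::
  "('o, 'a) category \<Rightarrow> 'k ring \<Rightarrow> ('o, 'a, 'k, 'v) cmodule \<Rightarrow> bool" where
  "fin_generated C k M \<longleftrightarrow>
    (\<exists>S. finite S \<and> (\<forall>(X, x) \<in> S. X \<in> Obj C \<and> x \<in> carrier (on_Obj M X)) \<and>
      (\<forall>X \<in> Obj C. generated_csubmodule C k M S X = carrier (on_Obj M X)))"

definition locally_noetherian_over ::
  "'v itself \<Rightarrow> ('o, 'a) category \<Rightarrow> 'k ring \<Rightarrow> bool" where
  "locally_noetherian_over _ C k \<longleftrightarrow>
    (\<forall>(M :: ('o, 'a, 'k, 'v) cmodule) N.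
      cmodule C k M \<and> fin_generated C k M \<and> csubmodule C k M N \<longrightarrow>
      fin_generated C k (sub_cmodule M N))"

text \<open>HOL cannot quantify over types inside a formula, so the types \<open>'k\<close> and \<open>'v\<close> in which the
  coefficient rings and the values of the modules live are parameters.\<close>

definition locally_noetherian ::
  "'k itself \<Rightarrow> 'v itself \<Rightarrow> ('o, 'a) category \<Rightarrow> bool" where
  "locally_noetherian _ _ C \<longleftrightarrow>
    (\<forall>k :: 'k ring. cring k \<and> noetherian_ring k \<longrightarrow> locally_noetherian_over TYPE('v) C k)"

lemma cmodule_sub_cmodule:
  assumes M: "cmodule C k M" and N: "csubmodule C k M N"
  shows "cmodule C k (sub_cmodule M N)"
proof -
  interpret cat_functor C "module_cat k" M using M by (simp add: cmodule_def)
  have mod: "module k (on_Obj M X)" if "X \<in> Obj C" for X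
    using on_Obj_closed[OF that] by (simp add: module_cat_def)
  have sub: "Module.submodule (N X) k (on_Obj M X)" if "X \<in> Obj C" for X
    using N that by (simp add: csubmodule_def)
  have subset: "N X \<subseteq> carrier (on_Obj M X)" if "X \<in> Obj C" for X
    using module.submoduleE(1)[OF mod[OF that] sub[OF that]] .
  have maps: "on_Hom M X Y f x \<in> N Y"
    if "X \<in> Obj C" "Y \<in> Obj C" "f \<in> Hom C X Y" "x \<in> N X" for X Y f x
    using N that unfolding csubmodule_def by blast
  show ?thesis
    unfolding cmodule_def
  proof unfold_locales
    fix X assume X: "X \<in> Obj C"
    show "on_Obj (sub_cmodule M N) X \<in> Obj (module_cat k)"
      using Module.submodule.submodule_is_module[OF sub[OF X] mod[OF X]]
      by (simp add: module_cat_def sub_cmodule_def)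
    show "on_Hom (sub_cmodule M N) X X (Ident C X) =
        Ident (module_cat k) (on_Obj (sub_cmodule M N) X)"
      using on_Hom_Ident[OF X] subset[OF X]
      by (auto simp: module_cat_def sub_cmodule_def fun_eq_iff)
  next
    fix X Y f assume XY: "X \<in> Obj C" "Y \<in> Obj C" "f \<in> Hom C X Y"
    then have "on_Hom M X Y f \<in> module_hom k (on_Obj M X) (on_Obj M Y)"
      using on_Hom_closed[OF XY] by (simp add: module_cat_def)
    moreover note subset[OF XY(1)] maps[OF XY]
      module.submoduleE(4,5)[OF mod[OF XY(1)] sub[OF XY(1)]]
    ultimately show "on_Hom (sub_cmodule M N) X Y f
        \<in> Hom (module_cat k) (on_Obj (sub_cmodule M N) X) (on_Obj (sub_cmodule M N) Y)"
      by (auto simp: module_cat_def sub_cmodule_def module_hom_def subset_iff)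
  next
    fix X Y Z f g
    assume XYZ: "X \<in> Obj C" "Y \<in> Obj C" "Z \<in> Obj C" "f \<in> Hom C X Y" "g \<in> Hom C Y Z"
    show "on_Hom (sub_cmodule M N) X Z (Comp C X Y Z g f) =
        Comp (module_cat k) (on_Obj (sub_cmodule M N) X) (on_Obj (sub_cmodule M N) Y)
          (on_Obj (sub_cmodule M N) Z) (on_Hom (sub_cmodule M N) Y Z g)
          (on_Hom (sub_cmodule M N) X Y f)"
      using on_Hom_Comp[OF XYZ] subset[OF XYZ(1)] maps[OF XYZ(1,2,4)]
      by (auto simp: module_cat_def sub_cmodule_def compose_def fun_eq_iff)
  qed
qed

lemma csubmodule_generated:
  assumes M: "cmodule C k M" and S: "\<forall>(X, x) \<in> S. X \<in> Obj C \<and> x \<in> carrier (on_Obj M X)"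
  shows "csubmodule C k M (generated_csubmodule C k M S)"
proof -
  interpret cat_functor C "module_cat k" M using M by (simp add: cmodule_def)
  have mod: "module k (on_Obj M X)" if "X \<in> Obj C" for X
    using on_Obj_closed[OF that] by (simp add: module_cat_def)
  have hom: "on_Hom M X Y f \<in> carrier (on_Obj M X) \<rightarrow> carrier (on_Obj M Y)"
    if "X \<in> Obj C" "Y \<in> Obj C" "f \<in> Hom C X Y" for X Y f
    using on_Hom_closed[OF that] by (auto simp: module_cat_def module_hom_def)
  have top: "csubmodule C k M (\<lambda>X. carrier (on_Obj M X))"
    using hom by (fastforce simp: csubmodule_def intro: module.carrier_is_submodule[OF mod])
  have sub: "Module.submodule (N X) k (on_Obj M X)" if "X \<in> Obj C" "csubmodule C k M N" for X N
    using that by (simp add: csubmodule_def)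
  have "Module.submodule (generated_csubmodule C k M S X) k (on_Obj M X)" if X: "X \<in> Obj C" for X
  proof (rule module.submoduleI[OF mod[OF X]])
    note subE = module.submoduleE[OF mod[OF X] sub[OF X]]
    interpret module k "on_Obj M X" by (rule mod[OF X])
    show "generated_csubmodule C k M S X \<subseteq> carrier (on_Obj M X)"
      using top S by (fastforce simp: generated_csubmodule_def)
    show "\<zero>\<^bsub>on_Obj M X\<^esub> \<in> generated_csubmodule C k M S X"
      using subgroup.one_closed[OF Module.submodule.axioms(1)[OF sub[OF X]]]
      by (fastforce simp: generated_csubmodule_def)
    show "\<ominus>\<^bsub>on_Obj M X\<^esub> a \<in> generated_csubmodule C k M S X"
      if "a \<in> generated_csubmodule C k M S X" for a
      using that subE(3) by (fastforce simp: generated_csubmodule_def)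
    show "a \<oplus>\<^bsub>on_Obj M X\<^esub> b \<in> generated_csubmodule C k M S X"
      if "a \<in> generated_csubmodule C k M S X" "b \<in> generated_csubmodule C k M S X" for a b
      using that subE(5) by (fastforce simp: generated_csubmodule_def)
    show "a \<odot>\<^bsub>on_Obj M X\<^esub> b \<in> generated_csubmodule C k M S X"
      if "a \<in> carrier k" "b \<in> generated_csubmodule C k M S X" for a b
      using that subE(4) by (fastforce simp: generated_csubmodule_def)
  qed
  moreover have "on_Hom M X Y f x \<in> generated_csubmodule C k M S Y"
    if "X \<in> Obj C" "Y \<in> Obj C" "f \<in> Hom C X Y" "x \<in> generated_csubmodule C k M S X" for X Y f x
  proof -
    have "on_Hom M X Y f x \<in> N Y" if N: "csubmodule C k M N" "\<forall>(Y, y) \<in> S. y \<in> N Y" for N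
    proof -
      have "x \<in> N X"
        using \<open>x \<in> generated_csubmodule C k M S X\<close> N by (auto simp: generated_csubmodule_def)
      then show ?thesis
        using N(1) \<open>X \<in> Obj C\<close> \<open>Y \<in> Obj C\<close> \<open>f \<in> Hom C X Y\<close>
        unfolding csubmodule_def by blast
    qed
    then show ?thesis by (auto simp: generated_csubmodule_def)
  qed
  ultimately show ?thesis by (auto simp: csubmodule_def)
qed

end

theory Submission
  imports Defs "HOL-Library.List_Lexorder" "HOL-Library.Product_Lexorder"
    "HOL-Library.Sublist" "HOL-Library.Ramsey"
begin

text \<open>
  The proof is a Groebner basis argument. Let \<open>M\<close> be generated by elements \<open>z\<^sub>i\<close> of the values of
  \<open>M\<close> at finitely many objects \<open>Z\<^sub>i\<close>. The value of \<open>M\<close> at \<open>X\<close> is spanned over \<open>k\<close> by the images of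
  the \<open>z\<^sub>i\<close> under the linear maps \<open>Z\<^sub>i \<rightarrow> X\<close>. After a choice of a basis of \<open>X\<close>, of length \<open>d\<close>, such a
  linear map is a list of \<open>d\<close> coordinate functionals on \<open>Z\<^sub>i\<close>, and as \<open>R\<close> is finite there are only
  finitely many functionals on \<open>Z\<^sub>i\<close>. So \<open>M\<close> is spanned at \<open>X\<close> by monomials \<open>(i, w)\<close>, where \<open>w\<close> is a word of
  length \<open>d\<close> over a finite alphabet.

  A map \<open>s\<close> from the positions \<open>{..<e}\<close> to the positions \<open>{..<d}\<close> induces a linear map from a module of
  rank \<open>d\<close> to one of rank \<open>e\<close> that copies coordinates, and this map sends every monomial \<open>(i, w)\<close> to
  \<open>(i, w \<circ> s)\<close>. If \<open>s\<close> reaches all positions of \<open>w\<close>, and for the first time in increasing order, words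
  that are lexicographically smaller than \<open>w\<close> stay smaller than \<open>w \<circ> s\<close>, so that leading terms go to
  leading terms. Higman's lemma shows that the relation ``\<open>w'\<close> is such a pullback \<open>w \<circ> s\<close> of \<open>w\<close>'' is a
  well-quasi-order on words (\<open>pulls_back_to_almost_full\<close>).

  For a submodule \<open>N\<close> the leading coefficients of the elements of \<open>N\<close> with a given leading monomial
  form an ideal of \<open>k\<close>, and this ideal grows along the relation on monomials. As \<open>k\<close> is Noetherian,
  finitely many of these ideals determine all the others, and lifts of finitely many generators of
  each of them generate \<open>N\<close> by the usual division argument (\<open>fin_generated_of_Groebner_order\<close>).
\<close>

section \<open>Higman's lemma for a finite alphabet\<close>

text \<open>The minimal bad sequence of Nash-Williams: the terms are chosen one after the other, each as
  small as possible among the continuations of the terms before it to a bad sequence.\<close>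

lemma exists_minimal_sequence:
  fixes bad :: "(nat \<Rightarrow> 'a) \<Rightarrow> bool" and size_of :: "'a \<Rightarrow> nat"
  assumes "bad f0"
  obtains g where "\<And>n. \<exists>f. bad f \<and> (\<forall>i\<le>n. f i = g i)"
    and "\<And>n f. bad f \<Longrightarrow> (\<forall>i<n. f i = g i) \<Longrightarrow> size_of (g n) \<le> size_of (f n)"
proof -
  define refines where "refines n f f' \<longleftrightarrow> (\<forall>i<n. f' i = f i) \<and>
      (\<forall>f''. bad f'' \<longrightarrow> (\<forall>i<n. f'' i = f i) \<longrightarrow> size_of (f' n) \<le> size_of (f'' n))"
    for n f f'
  have "\<exists>f'. bad f' \<and> refines n f f'" if "bad f" for f n
    using ex_has_least_nat[of "\<lambda>f''. bad f'' \<and> (\<forall>i<n. f'' i = f i)" f "\<lambda>f''. size_of (f'' n)"] that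
    unfolding refines_def by blast
  then have "\<exists>h. \<forall>n. bad (h n) \<and> refines n (h n) (h (Suc n))"
    by (intro dependent_nat_choice[of "\<lambda>_. bad" refines] exI[of bad, OF assms])
  then obtain h where "\<forall>n. bad (h n) \<and> refines n (h n) (h (Suc n))" ..
  then have h: "bad (h n)" and refines: "refines n (h n) (h (Suc n))" for n
    by simp_all
  define g where "g n = h (Suc n) n" for n
  have h_Suc: "h (Suc n) i = h n i" if "i < n" for n i
    using refines that unfolding refines_def by blast
  have h_eq: "h m i = g i" if "i < m" for m i
    using that by (induction m) (auto simp: g_def h_Suc less_Suc_eq)
  show thesis
  proof
    show "\<exists>f. bad f \<and> (\<forall>i\<le>n. f i = g i)" for n
      using h[of "Suc n"] h_eq[of _ "Suc n"] by (auto simp: less_Suc_eq_le)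
    show "size_of (g n) \<le> size_of (f n)" if "bad f" "\<forall>i<n. f i = g i" for n f
      using refines[of n] that h_eq unfolding refines_def g_def[of n] by metis
  qed
qed

lemma infinite_constant_subsequence:
  assumes "finite A" and "\<And>n::nat. f n \<in> A"
  obtains r :: "nat \<Rightarrow> nat" and a where "strict_mono r" and "\<And>n. f (r n) = a"
proof -
  have "finite (range f)"
    using assms by (meson finite_subset image_subsetI)
  then obtain m where m: "infinite {n. f n = f m}"
    using pigeonhole_infinite[of UNIV f] by auto
  show thesis
  proof
    show "strict_mono (enumerate {n. f n = f m})"
      by (rule strict_mono_enumerate[OF m])
    show "f (enumerate {n. f n = f m} n) = f m" for n
      using enumerate_in_set[OF m] by simp
  qed
qed

text \<open>In a minimal bad sequence all words are nonempty and infinitely many begin with the same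
  letter. Deleting this letter from them, and dropping the other words after the first of
  them, leaves a bad sequence, against minimality.\<close>

lemma Higman_finite_alphabet:
  fixes f :: "nat \<Rightarrow> 'a list"
  assumes "finite A" and "\<And>n. set (f n) \<subseteq> A"
  shows "\<exists>i j. i < j \<and> subseq (f i) (f j)"
proof (rule ccontr)
  define bad where "bad f \<longleftrightarrow> (\<forall>n. set (f n) \<subseteq> A) \<and> (\<forall>i j. i < j \<longrightarrow> \<not> subseq (f i) (f j))"
    for f :: "nat \<Rightarrow> 'a list"
  assume "\<not> ?thesis"
  then have "bad f" using assms by (auto simp: bad_def)
  then obtain g
    where prefix: "\<And>n. \<exists>f. bad f \<and> (\<forall>i\<le>n. f i = g i)"
      and least: "\<And>n f. bad f \<Longrightarrow> (\<forall>i<n. f i = g i) \<Longrightarrow> length (g n) \<le> length (f n)"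
    by (rule exists_minimal_sequence[of bad f length]) blast
  have g_A: "set (g n) \<subseteq> A" for n
    using prefix[of n] by (metis bad_def order_refl)
  have g_bad: "\<not> subseq (g i) (g j)" if "i < j" for i j
    using prefix[of j] that by (metis bad_def less_imp_le order_refl)
  have nonempty: "g n \<noteq> []" for n
    using g_bad[of n "Suc n"] by auto
  then have hd_A: "hd (g n) \<in> A" for n
    using g_A hd_in_set by blast
  obtain r :: "nat \<Rightarrow> nat" and a where r: "strict_mono r" and hd: "\<And>n. hd (g (r n)) = a"
    by (rule infinite_constant_subsequence[of A "\<lambda>n. hd (g n)", OF assms(1) hd_A]) blast
  have tl: "g (r n) = a # tl (g (r n))" for n
    using nonempty hd by (metis list.collapse)
  \<comment> \<open>The words up to the first one that begins with \<open>a\<close>, then the tails of those that begin with \<open>a\<close>.\<close>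
  define f' where "f' i = (if i < r 0 then g i else tl (g (r (i - r 0))))" for i
  have "\<not> subseq (f' i) (f' j)" if "i < j" for i j
  proof
    assume s: "subseq (f' i) (f' j)"
    consider "j < r 0" | "i < r 0" "r 0 \<le> j" | "r 0 \<le> i" by linarith
    then show False
    proof cases
      case 1
      then show ?thesis using s g_bad[OF that] that by (simp add: f'_def)
    next
      case 2
      then have "subseq (g i) (g (r (j - r 0)))"
        using s tl[of "j - r 0"] by (simp add: f'_def) (metis list_emb_Cons)
      moreover have "i < r (j - r 0)"
        using 2 r by (metis less_le_trans strict_mono_less_eq zero_le)
      ultimately show ?thesis using g_bad by blast
    next
      case 3
      then have "subseq (tl (g (r (i - r 0)))) (tl (g (r (j - r 0))))"
        using s that by (simp add: f'_def)
      then have "subseq (g (r (i - r 0))) (g (r (j - r 0)))"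
        using tl by (metis subseq_Cons2)
      moreover have "r (i - r 0) < r (j - r 0)"
        using 3 that r by (simp add: strict_mono_less)
      ultimately show ?thesis using g_bad by blast
    qed
  qed
  moreover have "set (f' i) \<subseteq> A" for i
    using g_A nonempty by (auto simp: f'_def dest: list.set_sel(2))
  ultimately have "length (g (r 0)) \<le> length (f' (r 0))"
    by (intro least) (auto simp: bad_def f'_def)
  then show False
    using nonempty[of "r 0"] by (cases "g (r 0)") (simp_all add: f'_def)
qed

section \<open>Pullbacks of words\<close>

text \<open>The list \<open>s\<close> is a map from the positions of \<open>w\<close> to those of \<open>u\<close> with \<open>w = u \<circ> s\<close>. The last
  condition says that composition with \<open>s\<close> respects the lexicographic order below \<open>u\<close>; the argument
  about leading terms uses exactly this.\<close>

definition pulls_back_to :: "'a::linorder list \<Rightarrow> 'a list \<Rightarrow> bool" where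
  "pulls_back_to u w \<longleftrightarrow> (\<exists>s. set s \<subseteq> {..<length u} \<and> w = map ((!) u) s \<and>
    (\<forall>v. length v = length u \<longrightarrow> v < u \<longrightarrow> map ((!) v) s < w))"

text \<open>An embedding of words as subsequences pairs letters, but a pullback must also place the letters
  of the larger word that are not paired. It can do so when they have occurred before. The flag, which
  tells whether a letter lies in \<open>S\<close> or occurred earlier in the word, makes embeddings respect first
  occurrences.\<close>

fun mark_old :: "'a set \<Rightarrow> 'a list \<Rightarrow> ('a \<times> bool) list" where
  "mark_old S [] = []"
| "mark_old S (a # w) = (a, a \<in> S) # mark_old (insert a S) w"

lemma first_occurrence_marked: "a \<in> set w \<Longrightarrow> a \<notin> S \<Longrightarrow> (a, False) \<in> set (mark_old S w)"
proof (induction w arbitrary: S)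
  case (Cons b w)
  then show ?case by (cases "a = b") auto
qed simp

lemma marked_new_not_old: "(a, False) \<in> set (mark_old S w) \<Longrightarrow> a \<notin> S"
  by (induction w arbitrary: S) auto

lemma set_mark_old: "set (mark_old S w) \<subseteq> set w \<times> UNIV"
  by (induction w arbitrary: S) auto

text \<open>The larger word is read from left to right and \<open>p\<close> holds the letters of \<open>u\<close> passed so far. A
  paired letter takes the next position of \<open>u\<close>. An unpaired letter \<open>a\<close> has occurred before: as both words
  use the same letters, a new \<open>a\<close> would have a marked first occurrence in \<open>u\<close> without a partner in \<open>w\<close>.
  So \<open>a\<close> can be copied from \<open>p\<close>, on which the words \<open>p @ v\<close> and \<open>p @ u\<close> agree. Hence these two
  pullbacks differ for the first time at the letter paired with the first position where \<open>v\<close> and \<open>u\<close>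
  differ.\<close>

lemma pullback_of_marked_subseq:
  fixes u w p :: "'a::linorder list"
  assumes "subseq (mark_old (set p) u) (mark_old (set p) w)"
    and "set p \<union> set u = set p \<union> set w"
  shows "\<exists>s. set s \<subseteq> {..<length (p @ u)} \<and> w = map ((!) (p @ u)) s \<and>
    (\<forall>v. length v = length u \<longrightarrow> v < u \<longrightarrow> map ((!) (p @ v)) s < w)"
  using assms
proof (induction w arbitrary: p u)
  case Nil
  then show ?case by (cases u) auto
next
  case (Cons a w)
  \<comment> \<open>The position \<open>j\<close> of \<open>a\<close> in \<open>p\<close> is the value of the pullback at the unpaired letter \<open>a\<close>.\<close>
  have copy: ?case
    if old: "a \<in> set p" and sub: "subseq (mark_old (set p) u) (mark_old (set p) w)"
  proof -
    obtain j where j: "j < length p" "p ! j = a"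
      using old by (auto simp: in_set_conv_nth)
    obtain s where "set s \<subseteq> {..<length (p @ u)}" "w = map ((!) (p @ u)) s"
        "\<forall>v. length v = length u \<longrightarrow> v < u \<longrightarrow> map ((!) (p @ v)) s < w"
      using Cons.IH[OF sub] Cons.prems(2) old by (auto simp: insert_absorb)
    then show ?case
      using j by (intro exI[of _ "j # s"]) (auto simp: nth_append_left)
  qed
  show ?case
  proof (cases u)
    case Nil
    then show ?thesis using copy Cons.prems by auto
  next
    case (Cons b u')
    show ?thesis
    proof (cases "a = b")
      case True
      then have "subseq (mark_old (set (p @ [a])) u') (mark_old (set (p @ [a])) w)"
        using Cons.prems(1) \<open>u = b # u'\<close> by simp
      moreover have "set (p @ [a]) \<union> set u' = set (p @ [a]) \<union> set w"
        using Cons.prems(2) \<open>u = b # u'\<close> True by auto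
      ultimately obtain s where s: "set s \<subseteq> {..<length ((p @ [a]) @ u')}"
          "w = map ((!) ((p @ [a]) @ u')) s"
          "\<And>v. length v = length u' \<Longrightarrow> v < u' \<Longrightarrow> map ((!) ((p @ [a]) @ v)) s < w"
        using Cons.IH by blast
      have "map ((!) (p @ v)) (length p # s) < a # w" if v: "length v = length u" "v < u" for v
      proof -
        obtain c v' where v': "v = c # v'" "length v' = length u'"
          using v(1) \<open>u = b # u'\<close> by (cases v) auto
        then show ?thesis
          using v(2) s(3)[of v'] True \<open>u = b # u'\<close> by (auto simp: nth_append)
      qed
      then show ?thesis
        using s(1,2) True \<open>u = b # u'\<close> by (intro exI[of _ "length p # s"]) auto
    next
      case False
      then have sub: "subseq (mark_old (set p) u) (mark_old (insert a (set p)) w)"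
        using Cons.prems(1) \<open>u = b # u'\<close> by simp
      have "a \<in> set p"
      proof (rule ccontr)
        assume "a \<notin> set p"
        then have "(a, False) \<in> set (mark_old (set p) u)"
          using Cons.prems(2) by (intro first_occurrence_marked) auto
        then have "(a, False) \<in> set (mark_old (insert a (set p)) w)"
          using list_emb_set[OF sub] by metis
        then show False using marked_new_not_old by (metis insertI1)
      qed
      then show ?thesis using copy sub by (simp add: insert_absorb)
    qed
  qed
qed

text \<open>By the pigeonhole principle one may assume that all words have the same tag and the same set of
  letters, and then Higman's lemma applies to the marked words.\<close>

lemma pulls_back_to_almost_full:
  fixes f :: "nat \<Rightarrow> nat \<times> 'a::linorder list"
  assumes "finite I" and "finite A" and f: "\<And>n. fst (f n) \<in> I \<and> set (snd (f n)) \<subseteq> A"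
  shows "\<exists>i j. i < j \<and> fst (f i) = fst (f j) \<and> pulls_back_to (snd (f i)) (snd (f j))"
proof -
  have fin: "finite (I \<times> Pow A)" using assms by simp
  have mem: "(fst (f n), set (snd (f n))) \<in> I \<times> Pow A" for n
    using f by auto
  obtain r :: "nat \<Rightarrow> nat" and c where r: "strict_mono r" and c: "\<And>n. (fst (f (r n)), set (snd (f (r n)))) = c"
    by (rule infinite_constant_subsequence[of "I \<times> Pow A" "\<lambda>n. (fst (f n), set (snd (f n)))", OF fin mem]) blast
  have "\<exists>i j. i < j \<and> subseq (mark_old {} (snd (f (r i)))) (mark_old {} (snd (f (r j))))"
  proof (rule Higman_finite_alphabet)
    show "finite (A \<times> (UNIV :: bool set))" using assms by simp
    show "set (mark_old {} (snd (f (r n)))) \<subseteq> A \<times> UNIV" for n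
      using f[of "r n"] set_mark_old[of "{}" "snd (f (r n))"] by blast
  qed
  then obtain i j where ij: "i < j" and
      sub: "subseq (mark_old {} (snd (f (r i)))) (mark_old {} (snd (f (r j))))"
    by blast
  have eq: "fst (f (r i)) = fst (f (r j)) \<and> set (snd (f (r i))) = set (snd (f (r j)))"
    using c by (metis prod.inject)
  then have "pulls_back_to (snd (f (r i))) (snd (f (r j)))"
    using pullback_of_marked_subseq[of "[]" "snd (f (r i))" "snd (f (r j))"] sub unfolding pulls_back_to_def by simp
  then show ?thesis using eq ij r by (meson strict_mono_less)
qed

section \<open>Almost full relations\<close>

text \<open>Ramsey's theorem for the colouring of the pairs \<open>i < j\<close> by whether \<open>P (f i) (f j)\<close> holds: the
  hypothesis excludes an infinite set all of whose pairs fail.\<close>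

lemma almost_full_monotone_subsequence:
  fixes f :: "nat \<Rightarrow> 'a"
  assumes "\<And>r :: nat \<Rightarrow> nat. \<exists>i j. i < j \<and> P (f (r i)) (f (r j))"
  obtains r :: "nat \<Rightarrow> nat" where "strict_mono r" and "\<And>i j. i < j \<Longrightarrow> P (f (r i)) (f (r j))"
proof -
  define colour :: "nat set \<Rightarrow> nat" where "colour e = (if P (f (Min e)) (f (Max e)) then 1 else 0)" for e
  obtain Y t where Y: "infinite Y" and mono: "\<And>x y. x \<in> Y \<Longrightarrow> y \<in> Y \<Longrightarrow> x \<noteq> y \<Longrightarrow> colour {x, y} = t"
    using Ramsey2[of "UNIV :: nat set" colour 2] by (force simp: colour_def)
  let ?r = "enumerate Y"
  have r: "strict_mono ?r" by (rule strict_mono_enumerate[OF Y])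
  have col: "(P (f (?r i)) (f (?r j))) = (t = 1)" if "i < j" for i j
  proof -
    have "?r i < ?r j" using r that by (simp add: strict_mono_less)
    then show ?thesis
      using mono[of "?r i" "?r j"] enumerate_in_set[OF Y] by (auto simp: colour_def split: if_splits)
  qed
  then have "t = 1" using assms[of ?r] by blast
  then show thesis using that[OF r] col by blast
qed

text \<open>Otherwise one could forever choose elements that lie above none of those chosen before.\<close>

lemma almost_full_finite_basis:
  assumes "\<And>f :: nat \<Rightarrow> 'a. range f \<subseteq> S \<Longrightarrow> \<exists>i j. i < j \<and> P (f i) (f j)"
  shows "\<exists>F. finite F \<and> F \<subseteq> S \<and> (\<forall>x\<in>S. \<exists>u\<in>F. P u x)"
proof (rule ccontr)
  assume no_basis: "\<not> ?thesis"
  have ex: "\<exists>x. x \<in> S \<and> (\<forall>u\<in>F. \<not> P u x)" if F: "finite F" "F \<subseteq> S" for F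
  proof (rule ccontr)
    assume none: "\<not> ?thesis"
    have "\<forall>x\<in>S. \<exists>u\<in>F. P u x"
    proof
      fix x assume "x \<in> S"
      with none show "\<exists>u\<in>F. P u x" by simp
    qed
    with F have "\<exists>F. finite F \<and> F \<subseteq> S \<and> (\<forall>x\<in>S. \<exists>u\<in>F. P u x)"
      by (intro exI[of _ F] conjI)
    with no_basis show False ..
  qed
  define new where "new F = (SOME x. x \<in> S \<and> (\<forall>u\<in>F. \<not> P u x))" for F
  have new: "new F \<in> S \<and> (\<forall>u\<in>F. \<not> P u (new F))" if "finite F" "F \<subseteq> S" for F
    unfolding new_def by (rule someI_ex[OF ex[OF that]])
  define F where "F = rec_nat {} (\<lambda>_ G. insert (new G) G)"
  have F_0: "F 0 = {}" and F_Suc: "F (Suc n) = insert (new (F n)) (F n)" for n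
    unfolding F_def by simp_all
  have F: "finite (F n) \<and> F n \<subseteq> S" for n
  proof (induction n)
    case (Suc n)
    then show ?case using new[of "F n"] unfolding F_Suc by blast
  qed (simp add: F_0)
  have mem: "new (F i) \<in> F j" if "i < j" for i j
    using that by (induction j) (auto simp: F_Suc less_Suc_eq)
  have range_new: "range (\<lambda>n. new (F n)) \<subseteq> S"
  proof (rule image_subsetI)
    show "new (F n) \<in> S" for n using new[of "F n"] F[of n] by simp
  qed
  obtain i j where "i < j" "P (new (F i)) (new (F j))"
    using assms[OF range_new] by blast
  moreover have "\<not> P u (new (F j))" if "u \<in> F j" for u
    using new[of "F j"] F[of j] that by simp
  ultimately show False using mem by metis
qed

section \<open>Leading coefficients in a module\<close>

context module
begin

text \<open>Zero and negatives are multiples by the scalars \<open>0\<close> and \<open>-1\<close>.\<close>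

lemma submodule_criterion:
  assumes "H \<subseteq> carrier M" and "H \<noteq> {}"
    and "\<And>x y. x \<in> H \<Longrightarrow> y \<in> H \<Longrightarrow> x \<oplus>\<^bsub>M\<^esub> y \<in> H"
    and smult: "\<And>c x. c \<in> carrier R \<Longrightarrow> x \<in> H \<Longrightarrow> c \<odot>\<^bsub>M\<^esub> x \<in> H"
  shows "Module.submodule H R M"
proof (rule submoduleI)
  obtain x where "x \<in> H" using assms(2) by blast
  then show "\<zero>\<^bsub>M\<^esub> \<in> H"
    using smult[of \<zero> x] assms(1) by auto
  show "\<ominus>\<^bsub>M\<^esub> x \<in> H" if "x \<in> H" for x
  proof -
    have "x \<in> carrier M" using that assms(1) by blast
    then show ?thesis using smult[of "\<ominus> \<one>" x] that by (simp add: smult_l_minus)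
  qed
qed (use assms in auto)

lemma submodule_zero: "Module.submodule H R M \<Longrightarrow> \<zero>\<^bsub>M\<^esub> \<in> H"
  using submoduleE(1,2,4)[of H] smult_l_null by (metis R.zero_closed all_not_in_conv subsetD)

lemma submodule_diff:
  assumes "Module.submodule H R M" "x \<in> H" "y \<in> H"
  shows "x \<ominus>\<^bsub>M\<^esub> y \<in> H"
  using submoduleE(3,5)[OF assms(1)] assms(2,3) unfolding a_minus_def by blast

lemma submodule_span:
  assumes "S \<subseteq> carrier M"
  shows "Module.submodule (span S) R M"
proof (rule submodule_criterion)
  interpret S: LinearCombinations.submodule R "span S" M
    by (rule span_is_submodule[OF assms])
  show "span S \<noteq> {}" using S.zero_closed by blast
qed (use span_is_submodule[OF assms] in
    \<open>auto dest: LinearCombinations.submodule.subset LinearCombinations.submodule.m_closed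
      LinearCombinations.submodule.smult_closed\<close>)

lemma span_minimal:
  assumes "S \<subseteq> H" and H: "Module.submodule H R M"
  shows "span S \<subseteq> H"
proof (rule span_is_subset[OF assms(1)])
  show "LinearCombinations.submodule R H M"
    using submoduleE[OF H] submodule_zero[OF H] module_axioms
    by (intro LinearCombinations.submodule.intro) auto
qed

lemma span_insertE:
  assumes S: "S \<subseteq> carrier M" and v: "v \<in> carrier M" and "x \<in> span (insert v S)"
  obtains c y where "c \<in> carrier R" and "y \<in> span S" and "x = c \<odot>\<^bsub>M\<^esub> v \<oplus>\<^bsub>M\<^esub> y"
proof -
  note spanE = submoduleE[OF submodule_span[OF S]]
  define H where "H = {c \<odot>\<^bsub>M\<^esub> v \<oplus>\<^bsub>M\<^esub> y | c y. c \<in> carrier R \<and> y \<in> span S}"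
  have "span (insert v S) \<subseteq> H"
  proof (rule span_minimal)
    have "v = \<one> \<odot>\<^bsub>M\<^esub> v \<oplus>\<^bsub>M\<^esub> \<zero>\<^bsub>M\<^esub>" using v by simp
    then have "v \<in> H"
      unfolding H_def using submodule_zero[OF submodule_span[OF S]] R.one_closed by blast
    moreover have "s \<in> H" if "s \<in> S" for s
    proof -
      have "s = \<zero> \<odot>\<^bsub>M\<^esub> v \<oplus>\<^bsub>M\<^esub> s" using v S that by auto
      then show ?thesis
        unfolding H_def using in_own_span[OF S] that R.zero_closed by blast
    qed
    ultimately show "insert v S \<subseteq> H" by blast
    show "Module.submodule H R M"
    proof (rule submodule_criterion)
      show "H \<subseteq> carrier M" unfolding H_def using spanE(1) v by blast
      show "H \<noteq> {}" using \<open>v \<in> H\<close> by blast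
      show "x \<oplus>\<^bsub>M\<^esub> y \<in> H" if xy: "x \<in> H" "y \<in> H" for x y
      proof -
        obtain c y1 d y2 where "c \<in> carrier R" "d \<in> carrier R" "y1 \<in> span S" "y2 \<in> span S"
            "x = c \<odot>\<^bsub>M\<^esub> v \<oplus>\<^bsub>M\<^esub> y1" "y = d \<odot>\<^bsub>M\<^esub> v \<oplus>\<^bsub>M\<^esub> y2"
          using xy unfolding H_def by blast
        moreover from this have "x \<oplus>\<^bsub>M\<^esub> y = (c \<oplus> d) \<odot>\<^bsub>M\<^esub> v \<oplus>\<^bsub>M\<^esub> (y1 \<oplus>\<^bsub>M\<^esub> y2)"
          using v spanE(1) by (simp add: subset_iff smult_l_distr M.a_ac)
        ultimately show ?thesis unfolding H_def using spanE(5) R.a_closed by blast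
      qed
      show "a \<odot>\<^bsub>M\<^esub> x \<in> H" if a: "a \<in> carrier R" and x: "x \<in> H" for a x
      proof -
        obtain c y where "c \<in> carrier R" "y \<in> span S" "x = c \<odot>\<^bsub>M\<^esub> v \<oplus>\<^bsub>M\<^esub> y"
          using x unfolding H_def by blast
        moreover from this have "a \<odot>\<^bsub>M\<^esub> x = (a \<otimes> c) \<odot>\<^bsub>M\<^esub> v \<oplus>\<^bsub>M\<^esub> a \<odot>\<^bsub>M\<^esub> y"
          using a v spanE(1) by (simp add: subset_iff smult_r_distr smult_assoc1)
        ultimately show ?thesis unfolding H_def using spanE(4) a R.m_closed by blast
      qed
    qed
  qed
  then show thesis using assms(3) that unfolding H_def by blast
qed

text \<open>An element of \<open>N\<close> may have several expansions in the family \<open>b\<close>, and each expansion into monomials up to \<open>m\<close>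
  contributes its coefficient at \<open>m\<close>, even if this is \<open>0\<close>. So these sets are ideals.\<close>

definition leading_coeffs :: "('n::linorder \<Rightarrow> 'c) \<Rightarrow> 'n set \<Rightarrow> 'c set \<Rightarrow> 'n \<Rightarrow> 'a set" where
  "leading_coeffs b B N m =
    {c \<in> carrier R. \<exists>y \<in> span (b ` {n \<in> B. n < m}). c \<odot>\<^bsub>M\<^esub> b m \<oplus>\<^bsub>M\<^esub> y \<in> N}"

lemma ideal_leading_coeffs:
  assumes b: "b ` B \<subseteq> carrier M" and N: "Module.submodule N R M" and m: "m \<in> B"
  shows "ideal (leading_coeffs b B N m) R" (is "ideal ?I R")
proof -
  have bm: "b m \<in> carrier M" using b m by blast
  have S: "b ` {n \<in> B. n < m} \<subseteq> carrier M" using b by blast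
  note spanE = submoduleE[OF submodule_span[OF S]] and NE = submoduleE[OF N]
  have smult: "a \<otimes> c \<in> ?I" if a: "a \<in> carrier R" and "c \<in> ?I" for a c
  proof -
    obtain y where y: "c \<in> carrier R" "y \<in> span (b ` {n \<in> B. n < m})"
        "c \<odot>\<^bsub>M\<^esub> b m \<oplus>\<^bsub>M\<^esub> y \<in> N"
      using \<open>c \<in> ?I\<close> unfolding leading_coeffs_def by blast
    then have "a \<odot>\<^bsub>M\<^esub> (c \<odot>\<^bsub>M\<^esub> b m \<oplus>\<^bsub>M\<^esub> y) = (a \<otimes> c) \<odot>\<^bsub>M\<^esub> b m \<oplus>\<^bsub>M\<^esub> a \<odot>\<^bsub>M\<^esub> y"
      using a bm spanE(1) by (simp add: subset_iff smult_r_distr smult_assoc1)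
    with y a spanE(4)[of a y] NE(4)[of a] show ?thesis
      unfolding leading_coeffs_def by (auto intro!: bexI[of _ "a \<odot>\<^bsub>M\<^esub> y"]) metis
  qed
  have add: "c \<oplus> d \<in> ?I" if cd: "c \<in> ?I" "d \<in> ?I" for c d
  proof -
    obtain y z where yz: "c \<in> carrier R" "y \<in> span (b ` {n \<in> B. n < m})"
        "c \<odot>\<^bsub>M\<^esub> b m \<oplus>\<^bsub>M\<^esub> y \<in> N" "d \<in> carrier R" "z \<in> span (b ` {n \<in> B. n < m})"
        "d \<odot>\<^bsub>M\<^esub> b m \<oplus>\<^bsub>M\<^esub> z \<in> N"
      using cd unfolding leading_coeffs_def by blast
    then have "(c \<odot>\<^bsub>M\<^esub> b m \<oplus>\<^bsub>M\<^esub> y) \<oplus>\<^bsub>M\<^esub> (d \<odot>\<^bsub>M\<^esub> b m \<oplus>\<^bsub>M\<^esub> z) =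
        (c \<oplus> d) \<odot>\<^bsub>M\<^esub> b m \<oplus>\<^bsub>M\<^esub> (y \<oplus>\<^bsub>M\<^esub> z)"
      using bm spanE(1) by (simp add: subset_iff smult_l_distr M.a_ac)
    with yz spanE(5)[of y z] NE(5) show ?thesis
      unfolding leading_coeffs_def by (auto intro!: bexI[of _ "y \<oplus>\<^bsub>M\<^esub> z"]) metis
  qed
  have zero: "\<zero> \<in> ?I"
    using submodule_zero[OF submodule_span[OF S]] submodule_zero[OF N] bm
    unfolding leading_coeffs_def by (auto intro!: bexI[of _ "\<zero>\<^bsub>M\<^esub>"])
  have sub: "?I \<subseteq> carrier R" unfolding leading_coeffs_def by blast
  show ?thesis
  proof (rule idealI)
    show "ring R" by (rule R.ring_axioms)
    show "subgroup ?I (add_monoid R)"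
    proof (rule R.add.subgroupI)
      show "?I \<noteq> {}" using zero by blast
      show "\<ominus> c \<in> ?I" if "c \<in> ?I" for c
        using smult[of "\<ominus> \<one>" c] that sub by (auto simp: R.l_minus)
    qed (use add sub in auto)
    show "c \<otimes> a \<in> ?I" if "c \<in> ?I" "a \<in> carrier R" for a c
      using smult[OF that(2,1)] that sub by (metis R.m_comm subsetD)
  qed (rule smult)
qed

text \<open>Division with remainder: an element of \<open>N\<close> with leading monomial \<open>m\<close> loses its leading term when
  a suitable element of \<open>L\<close> is subtracted, and the difference lies in \<open>N\<close> again because \<open>L \<subseteq> N\<close>. The
  induction is over the initial segments of \<open>B\<close>.\<close>

lemma submodule_le_of_leading_coeffs:
  assumes "finite B" and b: "b ` B \<subseteq> carrier M" and span: "carrier M \<subseteq> span (b ` B)"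
    and N: "Module.submodule N R M" and L: "Module.submodule L R M" and "L \<subseteq> N"
    and lead: "\<And>m. m \<in> B \<Longrightarrow> leading_coeffs b B N m \<subseteq> leading_coeffs b B L m"
  shows "N \<subseteq> L"
proof -
  have "A \<subseteq> B \<longrightarrow> (\<forall>l\<in>A. \<forall>n\<in>B. n < l \<longrightarrow> n \<in> A) \<longrightarrow> N \<inter> span (b ` A) \<subseteq> L" if "finite A" for A
    using that
  proof (induction A rule: finite_linorder_max_induct)
    case empty
    have "span {} \<subseteq> {\<zero>\<^bsub>M\<^esub>}"
      by (rule span_minimal) (auto intro!: submodule_criterion)
    then show ?case using submodule_zero[OF L] by auto
  next
    case (insert m A)
    show ?case
    proof (intro impI subsetI)
      fix x
      assume sub: "insert m A \<subseteq> B" and down: "\<forall>l\<in>insert m A. \<forall>n\<in>B. n < l \<longrightarrow> n \<in> insert m A"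
        and x: "x \<in> N \<inter> span (b ` insert m A)"
      \<comment> \<open>\<open>A\<close> is an initial segment, so spans of smaller monomials are spans over \<open>A\<close>.\<close>
      have below: "{n \<in> B. n < m} = A" using insert.hyps(2) sub down by auto
      have A: "b ` A \<subseteq> carrier M" and bm: "b m \<in> carrier M" using b sub by auto
      have IH: "N \<inter> span (b ` A) \<subseteq> L"
        using insert.IH sub down insert.hyps(2) by (metis insert_iff insert_subset less_asym)
      obtain c y where cy: "c \<in> carrier R" "y \<in> span (b ` A)" "x = c \<odot>\<^bsub>M\<^esub> b m \<oplus>\<^bsub>M\<^esub> y"
        using span_insertE[OF A bm, of x] x by auto
      then have "c \<in> leading_coeffs b B N m"
        using x unfolding leading_coeffs_def below by blast
      then have "c \<in> leading_coeffs b B L m" using lead sub by blast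
      then obtain z where z: "z \<in> span (b ` A)" "c \<odot>\<^bsub>M\<^esub> b m \<oplus>\<^bsub>M\<^esub> z \<in> L"
        unfolding leading_coeffs_def below by blast
      have yz: "y \<in> carrier M" "z \<in> carrier M"
        using cy z submoduleE(1)[OF submodule_span[OF A]] by auto
      have x_carrier: "c \<odot>\<^bsub>M\<^esub> b m \<in> carrier M" using cy bm by simp
      have "x \<ominus>\<^bsub>M\<^esub> (c \<odot>\<^bsub>M\<^esub> b m \<oplus>\<^bsub>M\<^esub> z) = y \<ominus>\<^bsub>M\<^esub> z"
        unfolding cy(3) a_minus_def using yz x_carrier
        by (simp add: M.minus_add M.a_ac M.r_neg M.r_neg1 M.r_neg2)
      moreover have "y \<ominus>\<^bsub>M\<^esub> z \<in> span (b ` A)"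
        using submodule_diff[OF submodule_span[OF A]] cy z by blast
      moreover have "x \<ominus>\<^bsub>M\<^esub> (c \<odot>\<^bsub>M\<^esub> b m \<oplus>\<^bsub>M\<^esub> z) \<in> N"
        using submodule_diff[OF N] x z \<open>L \<subseteq> N\<close> by blast
      ultimately have "x \<ominus>\<^bsub>M\<^esub> (c \<odot>\<^bsub>M\<^esub> b m \<oplus>\<^bsub>M\<^esub> z) \<in> L"
        using IH by auto
      then have "(x \<ominus>\<^bsub>M\<^esub> (c \<odot>\<^bsub>M\<^esub> b m \<oplus>\<^bsub>M\<^esub> z)) \<oplus>\<^bsub>M\<^esub> (c \<odot>\<^bsub>M\<^esub> b m \<oplus>\<^bsub>M\<^esub> z) \<in> L"
        using z submoduleE(5)[OF L] by blast
      then show "x \<in> L"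
        using x_carrier yz cy(3) by (simp add: a_minus_def M.a_assoc M.l_neg)
    qed
  qed
  from this[OF \<open>finite B\<close>] show ?thesis
    using span submoduleE(1)[OF N] by blast
qed

end

lemma module_hom_span:
  assumes "module R M" and "module R M'" and T: "T \<in> module_hom R M M'"
    and S: "S \<subseteq> carrier M" and S': "S' \<subseteq> carrier M'"
    and TS: "T ` S \<subseteq> module.span R M' S'"
  shows "T ` module.span R M S \<subseteq> module.span R M' S'"
proof -
  interpret M: module R M by fact
  interpret M': module R M' by fact
  interpret T: mod_hom R M M' T
    by unfold_locales (rule T)
  have "M.span S \<subseteq> {x \<in> carrier M. T x \<in> M'.span S'}"
  proof (rule M.span_minimal)
    show "S \<subseteq> {x \<in> carrier M. T x \<in> M'.span S'}"
      using S TS by blast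
    show "Module.submodule {x \<in> carrier M. T x \<in> M'.span S'} R M"
    proof (rule M.submodule_criterion)
      show "{x \<in> carrier M. T x \<in> M'.span S'} \<noteq> {}"
        using M'.submodule_zero[OF M'.submodule_span[OF S']] T.f0_is_0 by force
    qed (use M'.submoduleE[OF M'.submodule_span[OF S']] in auto)
  qed
  then show ?thesis by blast
qed

text \<open>\<open>T\<close> maps the span of the monomials below \<open>m\<close> into the span of those below \<open>m'\<close>, so an expansion with
  leading term \<open>c\<close> times \<open>b m\<close> becomes one with leading term \<open>c\<close> times \<open>b' m'\<close>.\<close>

lemma leading_coeffs_transport:
  assumes "module R M" and "module R M'" and T: "T \<in> module_hom R M M'"
    and b: "b ` B \<subseteq> carrier M" and b': "b' ` B' \<subseteq> carrier M'" and m: "m \<in> B"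
    and Tm: "T (b m) = b' m'"
    and below: "\<And>n. n \<in> B \<Longrightarrow> n < m \<Longrightarrow> T (b n) \<in> b' ` {n' \<in> B'. n' < m'}"
    and N: "T ` N \<subseteq> N'"
  shows "module.leading_coeffs R M b B N m \<subseteq> module.leading_coeffs R M' b' B' N' m'"
proof
  interpret M: module R M by fact
  interpret M': module R M' by fact
  interpret T: mod_hom R M M' T
    by unfold_locales (rule T)
  have S: "b ` {n \<in> B. n < m} \<subseteq> carrier M" using b by blast
  have S': "b' ` {n' \<in> B'. n' < m'} \<subseteq> carrier M'" (is "?S' \<subseteq> _") using b' by blast
  note spanE = M.submoduleE[OF M.submodule_span[OF S]]
  have "T ` b ` {n \<in> B. n < m} \<subseteq> M'.span ?S'"
    using below M'.in_own_span[OF S'] by blast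
  then have span: "T y \<in> M'.span ?S'" if "y \<in> M.span (b ` {n \<in> B. n < m})" for y
    using module_hom_span[OF assms(1,2) T S S'] that by blast
  fix c assume "c \<in> M.leading_coeffs b B N m"
  then obtain y where y: "c \<in> carrier R" "y \<in> M.span (b ` {n \<in> B. n < m})"
      "c \<odot>\<^bsub>M\<^esub> b m \<oplus>\<^bsub>M\<^esub> y \<in> N"
    unfolding M.leading_coeffs_def by blast
  have "T (c \<odot>\<^bsub>M\<^esub> b m \<oplus>\<^bsub>M\<^esub> y) = c \<odot>\<^bsub>M'\<^esub> b' m' \<oplus>\<^bsub>M'\<^esub> T y"
    using y(1) b m spanE(1) y(2) by (subst T.f_add) (auto simp: Tm)
  then have "c \<odot>\<^bsub>M'\<^esub> b' m' \<oplus>\<^bsub>M'\<^esub> T y \<in> N'" using y(3) N by force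
  then show "c \<in> M'.leading_coeffs b' B' N' m'"
    unfolding M'.leading_coeffs_def using y(1) span[OF y(2)] by blast
qed


lemma (in noetherian_ring) increasing_ideals_repeat:
  fixes J :: "nat \<Rightarrow> 'a set"
  assumes ideal: "\<And>i. ideal (J i) R" and mono: "\<And>i j. i < j \<Longrightarrow> J i \<subseteq> J j"
  shows "\<exists>i j. i < j \<and> J i = J j"
proof -
  have "subset.chain {I. ideal I R} (range J)"
    unfolding subset_chain_def using ideal mono by (metis (no_types, lifting) image_iff image_subsetI
        linorder_neqE_nat mem_Collect_eq order_refl)
  then have "\<Union> (range J) \<in> range J"
    by (intro ideal_chain_is_trivial) auto
  then obtain i where "\<Union> (range J) = J i" by blast
  then have "J (Suc i) \<subseteq> J i" by blast
  then show ?thesis using mono[of i "Suc i"] by (meson lessI subset_antisym)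
qed

section \<open>Groebner bases for modules over a category\<close>

lemma cmodule_module:
  assumes "cmodule C k M" and "X \<in> Obj C"
  shows "module k (on_Obj M X)"
  using cat_functor.on_Obj_closed[of C "module_cat k" M X] assms
  by (simp add: cmodule_def module_cat_def)

lemma cmodule_hom:
  assumes "cmodule C k M" and "X \<in> Obj C" and "Y \<in> Obj C" and "f \<in> Hom C X Y"
  shows "on_Hom M X Y f \<in> module_hom k (on_Obj M X) (on_Obj M Y)"
  using cat_functor.on_Hom_closed[of C "module_cat k" M X Y f] assms
  by (simp add: cmodule_def module_cat_def)

lemma csubmodule_of_sub_cmodule:
  assumes M: "cmodule C k M" and N: "csubmodule C k M N"
    and L: "csubmodule C k (sub_cmodule M N) L"
  shows "csubmodule C k M L" and "X \<in> Obj C \<Longrightarrow> L X \<subseteq> N X"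
proof -
  have le: "L X \<subseteq> N X \<and> Module.submodule (L X) k (on_Obj M X)" if X: "X \<in> Obj C" for X
  proof -
    interpret M: module k "on_Obj M X" by (rule cmodule_module[OF M X])
    have NX: "Module.submodule (N X) k (on_Obj M X)"
      using N X by (simp add: csubmodule_def)
    interpret S: module k "(on_Obj M X)\<lparr>carrier := N X\<rparr>"
      by (rule Module.submodule.submodule_is_module[OF NX M.module_axioms])
    have LX: "Module.submodule (L X) k ((on_Obj M X)\<lparr>carrier := N X\<rparr>)"
      using L X by (simp add: csubmodule_def sub_cmodule_def)
    have "L X \<subseteq> N X" using S.submoduleE(1)[OF LX] by simp
    moreover have "Module.submodule (L X) k (on_Obj M X)"
      using S.submoduleE(2,4,5)[OF LX] calculation M.submoduleE(1)[OF NX]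
      by (intro M.submodule_criterion) auto
    ultimately show ?thesis ..
  qed
  then show "X \<in> Obj C \<Longrightarrow> L X \<subseteq> N X" by blast
  have "on_Hom M X Y f x \<in> L Y"
    if "X \<in> Obj C" "Y \<in> Obj C" "f \<in> Hom C X Y" "x \<in> L X" for X Y f x
  proof -
    have "restrict (on_Hom M X Y f) (N X) ` L X \<subseteq> L Y"
      using L that(1-3) by (simp add: csubmodule_def sub_cmodule_def)
    moreover have "x \<in> N X" using le that by blast
    ultimately show ?thesis using that(4) by (auto simp: image_subset_iff)
  qed
  then show "csubmodule C k M L"
    unfolding csubmodule_def using le by blast
qed

text \<open>Reduces finite generation of \<open>N\<close>, regarded as a module of its own, to a statement about the
  submodules of \<open>M\<close> that lie in \<open>N\<close>.\<close>

lemma fin_generated_sub_cmoduleI: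
  assumes M: "cmodule C k M" and N: "csubmodule C k M N"
    and G: "finite G" "\<And>X x. (X, x) \<in> G \<Longrightarrow> X \<in> Obj C \<and> x \<in> N X"
    and gen: "\<And>L X. csubmodule C k M L \<Longrightarrow> (\<And>X. X \<in> Obj C \<Longrightarrow> L X \<subseteq> N X) \<Longrightarrow>
      (\<And>X x. (X, x) \<in> G \<Longrightarrow> x \<in> L X) \<Longrightarrow> X \<in> Obj C \<Longrightarrow> N X \<subseteq> L X"
  shows "fin_generated C k (sub_cmodule M N)"
  unfolding fin_generated_def
proof (intro exI[of _ G] conjI)
  show "\<forall>(X, x)\<in>G. X \<in> Obj C \<and> x \<in> carrier (on_Obj (sub_cmodule M N) X)"
    using G(2) by (auto simp: sub_cmodule_def)
  let ?gen = "generated_csubmodule C k (sub_cmodule M N) G"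
  have "csubmodule C k (sub_cmodule M N) ?gen"
    using G(2) by (intro csubmodule_generated cmodule_sub_cmodule M N) (auto simp: sub_cmodule_def)
  note L = csubmodule_of_sub_cmodule[OF M N this]
  have "x \<in> ?gen Y" if "(Y, x) \<in> G" for Y x
    using that by (auto simp: generated_csubmodule_def)
  then have "N X \<subseteq> ?gen X" if X: "X \<in> Obj C" for X
    using gen[OF L] X by blast
  then show "\<forall>X\<in>Obj C. ?gen X = carrier (on_Obj (sub_cmodule M N) X)"
    using L(2) by (auto simp: sub_cmodule_def)
qed (rule G(1))

text \<open>On pairs \<open>(X, m)\<close> consider the relation that \<open>m \<le> m'\<close> in the sense of \<open>le\<close> and that the ideals of leading
  coefficients of \<open>N\<close> agree. It is almost full: along an infinite \<open>le\<close>-increasing sequence the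
  ideals increase, so they repeat. So it has a finite basis \<open>F\<close>, and the generators of \<open>N\<close> are elements
  that realise finitely many generators of the ideals over \<open>F\<close>. A submodule that contains them has the same
  leading coefficients as \<open>N\<close> over \<open>F\<close>, then everywhere, and so it is all of \<open>N\<close>.\<close>

theorem fin_generated_of_Groebner_order:
  fixes C :: "('o, 'a) category" and k :: "'k ring" and M :: "('o, 'a, 'k, 'v) cmodule"
    and b :: "'o \<Rightarrow> 'n::linorder \<Rightarrow> 'v" and le :: "'n \<Rightarrow> 'n \<Rightarrow> bool"
  assumes k: "noetherian_ring k" and M: "cmodule C k M" and N: "csubmodule C k M N"
    and B: "\<And>X. X \<in> Obj C \<Longrightarrow> finite (B X)"
    and b: "\<And>X. X \<in> Obj C \<Longrightarrow> b X ` B X \<subseteq> carrier (on_Obj M X)"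
    and span: "\<And>X. X \<in> Obj C \<Longrightarrow> carrier (on_Obj M X) \<subseteq> module.span k (on_Obj M X) (b X ` B X)"
    and almost_full: "\<And>f :: nat \<Rightarrow> 'n. range f \<subseteq> (\<Union>X\<in>Obj C. B X) \<Longrightarrow> \<exists>i j. i < j \<and> le (f i) (f j)"
    and lift: "\<And>X Y m m'. X \<in> Obj C \<Longrightarrow> Y \<in> Obj C \<Longrightarrow> m \<in> B X \<Longrightarrow> m' \<in> B Y \<Longrightarrow> le m m' \<Longrightarrow>
      \<exists>f\<in>Hom C X Y. on_Hom M X Y f (b X m) = b Y m' \<and>
        (\<forall>n\<in>B X. n < m \<longrightarrow> on_Hom M X Y f (b X n) \<in> b Y ` {n' \<in> B Y. n' < m'})"
  shows "fin_generated C k (sub_cmodule M N)"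
proof -
  interpret k: noetherian_ring k by (rule k)
  define LC where "LC N X m = module.leading_coeffs k (on_Obj M X) (b X) (B X) (N X) m" for N X m
  have sub: "Module.submodule (L X) k (on_Obj M X)" if "csubmodule C k M L" "X \<in> Obj C" for L X
    using that by (simp add: csubmodule_def)
  have ideal: "ideal (LC L X m) k" if "csubmodule C k M L" "X \<in> Obj C" "m \<in> B X" for L X m
    unfolding LC_def
    by (rule module.ideal_leading_coeffs[OF cmodule_module[OF M that(2)] b[OF that(2)] sub[OF that(1,2)] that(3)])
  have mono: "LC L X m \<subseteq> LC L Y m'"
    if L: "csubmodule C k M L" and XY: "X \<in> Obj C" "Y \<in> Obj C" and m: "m \<in> B X" "m' \<in> B Y"
      and "le m m'" for L X Y m m'
  proof -
    obtain f where f: "f \<in> Hom C X Y" "on_Hom M X Y f (b X m) = b Y m'"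
        "\<And>n. n \<in> B X \<Longrightarrow> n < m \<Longrightarrow> on_Hom M X Y f (b X n) \<in> b Y ` {n' \<in> B Y. n' < m'}"
      using lift[OF XY m \<open>le m m'\<close>] by blast
    show ?thesis
      unfolding LC_def
    proof (rule leading_coeffs_transport[OF cmodule_module[OF M XY(1)] cmodule_module[OF M XY(2)]
          cmodule_hom[OF M XY f(1)] b[OF XY(1)] b[OF XY(2)] m(1) f(2,3)])
      show "on_Hom M X Y f ` L X \<subseteq> L Y"
        using L XY f(1) unfolding csubmodule_def by blast
    qed
  qed
  define I where "I = (SIGMA X:Obj C. B X)"
  define P where "P u v \<longleftrightarrow> le (snd u) (snd v) \<and> LC N (fst u) (snd u) = LC N (fst v) (snd v)" for u v
  have "\<exists>F. finite F \<and> F \<subseteq> I \<and> (\<forall>v\<in>I. \<exists>u\<in>F. P u v)"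
  proof (rule almost_full_finite_basis)
    fix f :: "nat \<Rightarrow> 'o \<times> 'n" assume f: "range f \<subseteq> I"
    have fI: "fst (f i) \<in> Obj C" "snd (f i) \<in> B (fst (f i))" for i
      using f rangeI[of f i] unfolding I_def by (metis mem_Sigma_iff prod.collapse subsetD)+
    have "\<exists>i j. i < j \<and> le (snd (f (r i))) (snd (f (r j)))" for r :: "nat \<Rightarrow> nat"
      using almost_full[of "\<lambda>i. snd (f (r i))"] fI by auto
    then obtain r :: "nat \<Rightarrow> nat" where r: "strict_mono r"
      and le: "\<And>i j. i < j \<Longrightarrow> le (snd (f (r i))) (snd (f (r j)))"
      using almost_full_monotone_subsequence[of "\<lambda>u v. le (snd u) (snd v)" f] by auto
    have "\<exists>i j. i < j \<and> LC N (fst (f (r i))) (snd (f (r i))) = LC N (fst (f (r j))) (snd (f (r j)))"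
      by (rule k.increasing_ideals_repeat) (use ideal mono N fI le in auto)
    then show "\<exists>i j. i < j \<and> P (f i) (f j)"
      unfolding P_def using le r by (metis strict_mono_less)
  qed
  then obtain F where F: "finite F" "F \<subseteq> I" "\<And>v. v \<in> I \<Longrightarrow> \<exists>u\<in>F. P u v" by blast
  have "\<exists>A. \<forall>u\<in>F. A u \<subseteq> carrier k \<and> finite (A u) \<and> LC N (fst u) (snd u) = Idl\<^bsub>k\<^esub> (A u)"
  proof (rule bchoice, rule ballI)
    fix u assume "u \<in> F"
    then have "ideal (LC N (fst u) (snd u)) k" using F(2) ideal[OF N] by (auto simp: I_def)
    then show "\<exists>A. A \<subseteq> carrier k \<and> finite A \<and> LC N (fst u) (snd u) = Idl\<^bsub>k\<^esub> A"
      using k.finetely_gen by blast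
  qed
  then obtain A where A: "\<And>u. u \<in> F \<Longrightarrow> A u \<subseteq> carrier k" "\<And>u. u \<in> F \<Longrightarrow> finite (A u)"
      "\<And>u. u \<in> F \<Longrightarrow> LC N (fst u) (snd u) = Idl\<^bsub>k\<^esub> (A u)" by blast
  define leads where "leads u c x \<longleftrightarrow> (\<exists>y\<in>module.span k (on_Obj M (fst u)) (b (fst u) ` {n \<in> B (fst u). n < snd u}).
      x = c \<odot>\<^bsub>on_Obj M (fst u)\<^esub> b (fst u) (snd u) \<oplus>\<^bsub>on_Obj M (fst u)\<^esub> y)" for u c x
  have LC_iff: "c \<in> LC L (fst u) (snd u) \<longleftrightarrow> c \<in> carrier k \<and> (\<exists>x\<in>L (fst u). leads u c x)"
    if "u \<in> I" for L u c
  proof -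
    have "fst u \<in> Obj C" using that by (auto simp: I_def)
    then show ?thesis
      unfolding LC_def leads_def module.leading_coeffs_def[OF cmodule_module[OF M \<open>fst u \<in> Obj C\<close>]]
      by blast
  qed
  have "\<exists>g. \<forall>w\<in>Sigma F A. g w \<in> N (fst (fst w)) \<and> leads (fst w) (snd w) (g w)"
  proof (rule bchoice, rule ballI)
    fix w assume "w \<in> Sigma F A"
    then have w: "fst w \<in> F" "snd w \<in> A (fst w)" by auto
    then have "snd w \<in> LC N (fst (fst w)) (snd (fst w))"
      using A k.genideal_self by blast
    then show "\<exists>x. x \<in> N (fst (fst w)) \<and> leads (fst w) (snd w) x"
      using LC_iff[of "fst w"] w F(2) by blast
  qed
  then obtain g where g: "\<And>u c. u \<in> F \<Longrightarrow> c \<in> A u \<Longrightarrow> g (u, c) \<in> N (fst u) \<and> leads u c (g (u, c))"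
    by fastforce
  define G where "G = (\<lambda>w. (fst (fst w), g w)) ` Sigma F A"
  show ?thesis
  proof (rule fin_generated_sub_cmoduleI[OF M N, of G])
    show "finite G" unfolding G_def using F(1) A(2) by simp
    show "X \<in> Obj C \<and> x \<in> N X" if "(X, x) \<in> G" for X x
      using that g F(2) by (auto simp: G_def I_def)
    fix L X assume L: "csubmodule C k M L" "\<And>X. X \<in> Obj C \<Longrightarrow> L X \<subseteq> N X"
      and GL: "\<And>X x. (X, x) \<in> G \<Longrightarrow> x \<in> L X" and X: "X \<in> Obj C"
    have basis: "LC N (fst u) (snd u) \<subseteq> LC L (fst u) (snd u)" if u: "u \<in> F" for u
    proof -
      have uI: "u \<in> I" using u F(2) by blast
      have "c \<in> LC L (fst u) (snd u)" if c: "c \<in> A u" for c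
      proof -
        have "(fst u, g (u, c)) \<in> G" unfolding G_def using u c by force
        then show ?thesis
          using LC_iff[OF uI] GL g[OF u c] A(1)[OF u] c by blast
      qed
      moreover have "ideal (LC L (fst u) (snd u)) k"
        using ideal[OF L(1)] uI by (auto simp: I_def)
      ultimately show ?thesis
        unfolding A(3)[OF u] by (intro k.genideal_minimal) auto
    qed
    have "LC N X m \<subseteq> LC L X m" if m: "m \<in> B X" for m
    proof -
      have "(X, m) \<in> I" using X m by (simp add: I_def)
      then obtain u where u: "u \<in> F" "le (snd u) m" "LC N (fst u) (snd u) = LC N X m"
        using F(3) unfolding P_def by fastforce
      moreover have "fst u \<in> Obj C" "snd u \<in> B (fst u)"
        using u(1) F(2) by (auto simp: I_def)
      ultimately have "LC L (fst u) (snd u) \<subseteq> LC L X m"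
        using mono[OF L(1) _ X _ m] by blast
      then show ?thesis using basis[OF u(1)] u(3) by blast
    qed
    then show "N X \<subseteq> L X"
      unfolding LC_def
      by (intro module.submodule_le_of_leading_coeffs[OF cmodule_module[OF M X] B[OF X] b[OF X] span[OF X]
            sub[OF N X] sub[OF L(1) X] L(2)[OF X]])
  qed
qed

section \<open>Linear maps into free modules as words\<close>

text \<open>A basis given by the coordinates that it defines; uniqueness of the coordinates takes the
  place of linear independence.\<close>

locale coordinates = module R M for R (structure) and M (structure) +
  fixes d :: nat and x :: "nat \<Rightarrow> 'c" and coord :: "'c \<Rightarrow> nat \<Rightarrow> 'a"
  assumes basis_closed: "i < d \<Longrightarrow> x i \<in> carrier M"
    and coord_closed: "v \<in> carrier M \<Longrightarrow> i < d \<Longrightarrow> coord v i \<in> carrier R"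
    and expansion: "v \<in> carrier M \<Longrightarrow> (\<Oplus>\<^bsub>M\<^esub>i\<in>{..<d}. coord v i \<odot>\<^bsub>M\<^esub> x i) = v"
    and coord_unique: "c \<in> {..<d} \<rightarrow> carrier R \<Longrightarrow> i < d \<Longrightarrow>
      coord (\<Oplus>\<^bsub>M\<^esub>j\<in>{..<d}. c j \<odot>\<^bsub>M\<^esub> x j) i = c i"
begin

definition combination :: "(nat \<Rightarrow> 'a) \<Rightarrow> 'c" where
  "combination c = (\<Oplus>\<^bsub>M\<^esub>j\<in>{..<d}. c j \<odot>\<^bsub>M\<^esub> x j)"

lemma combination_closed: "c \<in> {..<d} \<rightarrow> carrier R \<Longrightarrow> combination c \<in> carrier M"
  unfolding combination_def using basis_closed by (intro M.finsum_closed) auto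

lemma combination_coord: "v \<in> carrier M \<Longrightarrow> combination (coord v) = v"
  unfolding combination_def by (rule expansion)

lemma coord_combination: "c \<in> {..<d} \<rightarrow> carrier R \<Longrightarrow> i < d \<Longrightarrow> coord (combination c) i = c i"
  unfolding combination_def by (rule coord_unique)

lemma combination_cong:
  "c' \<in> {..<d} \<rightarrow> carrier R \<Longrightarrow> (\<And>i. i < d \<Longrightarrow> c i = c' i) \<Longrightarrow> combination c = combination c'"
  unfolding combination_def using basis_closed by (intro M.finsum_cong') auto

lemma combination_add:
  assumes "c \<in> {..<d} \<rightarrow> carrier R" and "c' \<in> {..<d} \<rightarrow> carrier R"
  shows "combination (\<lambda>i. c i \<oplus> c' i) = combination c \<oplus>\<^bsub>M\<^esub> combination c'"
proof -
  have "combination (\<lambda>i. c i \<oplus> c' i) =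
      (\<Oplus>\<^bsub>M\<^esub>i\<in>{..<d}. c i \<odot>\<^bsub>M\<^esub> x i \<oplus>\<^bsub>M\<^esub> c' i \<odot>\<^bsub>M\<^esub> x i)"
    unfolding combination_def using assms basis_closed
    by (intro M.finsum_cong') (auto simp: smult_l_distr Pi_iff)
  also have "\<dots> = combination c \<oplus>\<^bsub>M\<^esub> combination c'"
    unfolding combination_def using assms basis_closed by (intro M.finsum_addf) (auto simp: Pi_iff)
  finally show ?thesis .
qed

lemma combination_smult:
  assumes "c \<in> {..<d} \<rightarrow> carrier R" and "r \<in> carrier R"
  shows "combination (\<lambda>i. r \<otimes> c i) = r \<odot>\<^bsub>M\<^esub> combination c"
proof -
  have "combination (\<lambda>i. r \<otimes> c i) = (\<Oplus>\<^bsub>M\<^esub>i\<in>{..<d}. r \<odot>\<^bsub>M\<^esub> (c i \<odot>\<^bsub>M\<^esub> x i))"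
    unfolding combination_def using assms basis_closed
    by (intro M.finsum_cong') (auto simp: smult_assoc1 Pi_iff)
  also have "\<dots> = r \<odot>\<^bsub>M\<^esub> combination c"
    unfolding combination_def using assms basis_closed
    by (intro finsum_smult_ldistr[symmetric]) (auto simp: Pi_iff)
  finally show ?thesis .
qed

lemma coord_add:
  assumes "v \<in> carrier M" and "w \<in> carrier M" and "i < d"
  shows "coord (v \<oplus>\<^bsub>M\<^esub> w) i = coord v i \<oplus> coord w i"
proof -
  have "v \<oplus>\<^bsub>M\<^esub> w = combination (\<lambda>i. coord v i \<oplus> coord w i)"
    using assms coord_closed by (simp add: combination_add combination_coord Pi_iff)
  then show ?thesis
    using assms coord_closed by (simp add: coord_combination Pi_iff)
qed

lemma coord_smult:
  assumes "r \<in> carrier R" and "v \<in> carrier M" and "i < d"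
  shows "coord (r \<odot>\<^bsub>M\<^esub> v) i = r \<otimes> coord v i"
proof -
  have "r \<odot>\<^bsub>M\<^esub> v = combination (\<lambda>i. r \<otimes> coord v i)"
    using assms coord_closed by (simp add: combination_smult combination_coord Pi_iff)
  then show ?thesis
    using assms coord_closed by (simp add: coord_combination Pi_iff)
qed

lemma finite_carrier:
  assumes "finite (carrier R)"
  shows "finite (carrier M)"
proof (rule finite_surj)
  show "finite ({..<d} \<rightarrow>\<^sub>E carrier R)" using assms by (intro finite_PiE) auto
  show "carrier M \<subseteq> combination ` ({..<d} \<rightarrow>\<^sub>E carrier R)"
  proof
    fix v assume v: "v \<in> carrier M"
    then have "v = combination (restrict (coord v) {..<d})"
      using combination_cong[of "coord v" "restrict (coord v) {..<d}"] coord_closed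
      by (simp add: combination_coord Pi_iff)
    then show "v \<in> combination ` ({..<d} \<rightarrow>\<^sub>E carrier R)"
      using v coord_closed by (metis image_eqI lessThan_iff restrict_PiE_iff)
  qed
qed

end

lemma free_coordinates:
  assumes "free_of_finite_rank R A"
  shows "\<exists>d x coord. coordinates R A d x coord"
proof -
  obtain B where A: "module R A" and B: "finite B" "B \<subseteq> carrier A"
      "module.lin_indpt R A B" "module.gen_set R A B"
    using assms unfolding free_of_finite_rank_def by blast
  interpret module R A by (rule A)
  obtain x where x: "bij_betw x {..<card B} B"
    using ex_bij_betw_nat_finite[OF B(1)] by (auto simp: atLeast0LessThan)
  define d where "d = card B"
  define y where "y = inv_into {..<d} x"
  have y: "y v < d" "x (y v) = v" if "v \<in> B" for v
    using x that bij_betw_inv_into[OF x] unfolding y_def d_def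
    by (auto simp: bij_betw_inv_into_right dest: bij_betwE)
  have yx: "y (x i) = i" and xB: "x i \<in> B" if "i < d" for i
    using x that unfolding y_def d_def by (auto simp: bij_betw_inv_into_left dest: bij_betwE)
  have sum: "lincomb a B = (\<Oplus>\<^bsub>A\<^esub>i\<in>{..<d}. a (x i) \<odot>\<^bsub>A\<^esub> x i)" if "a \<in> B \<rightarrow> carrier R" for a
  proof -
    have "B = x ` {..<d}" and "inj_on x {..<d}" using x unfolding d_def by (auto simp: bij_betw_def)
    then show ?thesis
      unfolding lincomb_def using that B(2) by (subst \<open>B = _\<close>, intro M.finsum_reindex) auto
  qed
  \<comment> \<open>Coefficients with respect to the set \<open>B\<close>; \<open>x\<close> numbers \<open>B\<close> with inverse \<open>y\<close>.\<close>
  have "\<exists>c. c \<in> B \<rightarrow> carrier R \<and> lincomb c B = v" if "v \<in> carrier A" for v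
    using finite_in_span[OF B(1,2)] B(4) that by blast
  then obtain c where c: "\<And>v. v \<in> carrier A \<Longrightarrow> c v \<in> B \<rightarrow> carrier R \<and> lincomb (c v) B = v"
    by metis
  have uniq: "a u = a' u"
    if a: "a \<in> B \<rightarrow> carrier R" "a' \<in> B \<rightarrow> carrier R" "lincomb a B = lincomb a' B" and u: "u \<in> B" for a a' u
  proof (rule ccontr)
    assume "a u \<noteq> a' u"
    then have "a u \<ominus>\<^bsub>R\<^esub> a' u \<noteq> \<zero>\<^bsub>R\<^esub>"
      using a u by (auto simp: R.r_right_minus_eq Pi_iff)
    moreover have "lincomb (\<lambda>v. a v \<ominus>\<^bsub>R\<^esub> a' v) B = \<zero>\<^bsub>A\<^esub>"
      using lincomb_diff[OF B(1,2) a(1,2)] a(3) lincomb_closed[OF B(2) a(2)]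
      by (simp add: M.r_neg a_minus_def)
    ultimately have "lin_dep B"
      using B(1) a u by (intro lin_dep_crit[of B B "\<lambda>v. a v \<ominus>\<^bsub>R\<^esub> a' v" u]) auto
    with B(3) show False by blast
  qed
  have "coordinates R A d x (\<lambda>v i. c v (x i))"
  proof
    show "x i \<in> carrier A" if "i < d" for i using xB that B(2) by blast
    show "c v (x i) \<in> carrier R" if "v \<in> carrier A" "i < d" for v i
      using c xB that by blast
    show "(\<Oplus>\<^bsub>A\<^esub>i\<in>{..<d}. c v (x i) \<odot>\<^bsub>A\<^esub> x i) = v" if "v \<in> carrier A" for v
      using sum c that by metis
    fix e i assume e: "e \<in> {..<d} \<rightarrow> carrier R" and i: "i < d"
    define v where "v = (\<Oplus>\<^bsub>A\<^esub>j\<in>{..<d}. e j \<odot>\<^bsub>A\<^esub> x j)"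
    have ey: "(\<lambda>u. e (y u)) \<in> B \<rightarrow> carrier R" using e y by auto
    have "lincomb (\<lambda>u. e (y u)) B = v"
      unfolding sum[OF ey] v_def using e xB yx B(2) by (intro M.finsum_cong') (auto simp: Pi_iff subset_iff)
    moreover from this have "v \<in> carrier A" using lincomb_closed[OF B(2) ey] by simp
    ultimately show "c v (x i) = e i"
      using uniq[of "c v" "\<lambda>u. e (y u)" "x i"] c ey xB[OF i] yx[OF i] by simp
  qed
  then show ?thesis by blast
qed

definition functionals :: "('r, 'q) ring_scheme \<Rightarrow> ('r, 'm) module \<Rightarrow> ('m \<Rightarrow> 'r) set" where
  "functionals R Z = {\<phi> \<in> carrier Z \<rightarrow>\<^sub>E carrier R.
    (\<forall>u\<in>carrier Z. \<forall>v\<in>carrier Z. \<phi> (u \<oplus>\<^bsub>Z\<^esub> v) = \<phi> u \<oplus>\<^bsub>R\<^esub> \<phi> v) \<and>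
    (\<forall>r\<in>carrier R. \<forall>v\<in>carrier Z. \<phi> (r \<odot>\<^bsub>Z\<^esub> v) = r \<otimes>\<^bsub>R\<^esub> \<phi> v)}"

lemma finite_functionals:
  assumes "finite (carrier R)" and "finite (carrier Z)"
  shows "finite (functionals R Z)"
  unfolding functionals_def using finite_PiE[OF assms(2), of "\<lambda>_. carrier R"] assms(1) by simp

text \<open>The linear map with the letters of \<open>w\<close> as its rows: the functional named by the \<open>i\<close>-th letter
  gives the \<open>i\<close>-th coordinate.\<close>

definition (in coordinates) word_map ::
  "('l \<Rightarrow> 'z \<Rightarrow> 'a) \<Rightarrow> ('a, 'z) module \<Rightarrow> 'l list \<Rightarrow> 'z \<Rightarrow> 'c" where
  "word_map letter Z w = (\<lambda>z\<in>carrier Z. combination (\<lambda>i. letter (w ! i) z))"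

lemma (in coordinates) letters_closed:
  assumes "length w = d" and "\<And>l. l \<in> set w \<Longrightarrow> letter l \<in> functionals R Z" and "z \<in> carrier Z"
  shows "(\<lambda>i. letter (w ! i) z) \<in> {..<d} \<rightarrow> carrier R"
proof
  fix i assume "i \<in> {..<d}"
  then have "letter (w ! i) \<in> functionals R Z" using assms(1,2) by auto
  then show "letter (w ! i) z \<in> carrier R" using assms(3) unfolding functionals_def by auto
qed

lemma (in coordinates) word_map_hom:
  assumes "module R Z"
    and w: "length w = d" "\<And>l. l \<in> set w \<Longrightarrow> letter l \<in> functionals R Z"
  shows "word_map letter Z w \<in> module_hom R Z M \<inter> extensional (carrier Z)"
proof -
  interpret Z: module R Z by fact
  have fl: "letter (w ! i) \<in> functionals R Z" if "i < d" for i
    using w that by auto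
  have closed: "(\<lambda>i. letter (w ! i) z) \<in> {..<d} \<rightarrow> carrier R" if "z \<in> carrier Z" for z
    by (rule letters_closed[OF w that])
  have add: "combination (\<lambda>i. letter (w ! i) (u \<oplus>\<^bsub>Z\<^esub> v)) =
      combination (\<lambda>i. letter (w ! i) u) \<oplus>\<^bsub>M\<^esub> combination (\<lambda>i. letter (w ! i) v)"
    if uv: "u \<in> carrier Z" "v \<in> carrier Z" for u v
  proof -
    have "combination (\<lambda>i. letter (w ! i) (u \<oplus>\<^bsub>Z\<^esub> v)) =
        combination (\<lambda>i. letter (w ! i) u \<oplus> letter (w ! i) v)"
    proof (rule combination_cong)
      show "(\<lambda>i. letter (w ! i) u \<oplus> letter (w ! i) v) \<in> {..<d} \<rightarrow> carrier R"
        using closed uv by (auto simp: Pi_iff)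
      show "letter (w ! i) (u \<oplus>\<^bsub>Z\<^esub> v) = letter (w ! i) u \<oplus> letter (w ! i) v" if "i < d" for i
        using fl[OF that] uv unfolding functionals_def by blast
    qed
    then show ?thesis using closed uv by (simp add: combination_add)
  qed
  have smult: "combination (\<lambda>i. letter (w ! i) (r \<odot>\<^bsub>Z\<^esub> v)) = r \<odot>\<^bsub>M\<^esub> combination (\<lambda>i. letter (w ! i) v)"
    if rv: "r \<in> carrier R" "v \<in> carrier Z" for r v
  proof -
    have "combination (\<lambda>i. letter (w ! i) (r \<odot>\<^bsub>Z\<^esub> v)) = combination (\<lambda>i. r \<otimes> letter (w ! i) v)"
    proof (rule combination_cong)
      show "(\<lambda>i. r \<otimes> letter (w ! i) v) \<in> {..<d} \<rightarrow> carrier R"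
        using closed rv by (auto simp: Pi_iff)
      show "letter (w ! i) (r \<odot>\<^bsub>Z\<^esub> v) = r \<otimes> letter (w ! i) v" if "i < d" for i
        using fl[OF that] rv unfolding functionals_def by blast
    qed
    then show ?thesis using closed rv by (simp add: combination_smult)
  qed
  show ?thesis
    using combination_closed[OF closed] add smult
    by (auto simp: word_map_def module_hom_def)
qed

lemma (in coordinates) hom_is_word_map:
  assumes "module R Z" and g: "g \<in> module_hom R Z M \<inter> extensional (carrier Z)"
    and letters: "functionals R Z \<subseteq> letter ` A"
  shows "\<exists>w. length w = d \<and> set w \<subseteq> {l \<in> A. letter l \<in> functionals R Z} \<and> g = word_map letter Z w"
proof -
  interpret Z: module R Z by fact
  have gc: "g z \<in> carrier M" if "z \<in> carrier Z" for z
    using g that by (auto simp: module_hom_def)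
  define \<phi> where "\<phi> i = (\<lambda>z\<in>carrier Z. coord (g z) i)" for i
  have \<phi>: "\<phi> i \<in> functionals R Z" if "i < d" for i
  proof -
    have "g (u \<oplus>\<^bsub>Z\<^esub> v) = g u \<oplus>\<^bsub>M\<^esub> g v" if "u \<in> carrier Z" "v \<in> carrier Z" for u v
      using g that by (auto simp: module_hom_def)
    moreover have "g (r \<odot>\<^bsub>Z\<^esub> v) = r \<odot>\<^bsub>M\<^esub> g v" if "v \<in> carrier Z" "r \<in> carrier R" for v r
      using g that by (auto simp: module_hom_def)
    ultimately show ?thesis
      using that gc coord_closed coord_add coord_smult by (auto simp: functionals_def \<phi>_def)
  qed
  then have "\<forall>i\<in>{..<d}. \<exists>l. l \<in> A \<and> letter l = \<phi> i" using letters by fastforce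
  then obtain l where l: "\<And>i. i < d \<Longrightarrow> l i \<in> A \<and> letter (l i) = \<phi> i"
    using bchoice by (metis lessThan_iff)
  define w where "w = map l [0..<d]"
  have "g z = word_map letter Z w z" if z: "z \<in> carrier Z" for z
  proof -
    have "combination (\<lambda>i. letter (w ! i) z) = combination (coord (g z))"
      using l z coord_closed[OF gc[OF z]] by (intro combination_cong) (auto simp: w_def \<phi>_def)
    then show ?thesis using z combination_coord[OF gc[OF z]] by (simp add: word_map_def)
  qed
  then have "g = word_map letter Z w"
    using g by (intro extensionalityI[of g "carrier Z"]) (auto simp: word_map_def)
  moreover have "length w = d" "set w \<subseteq> {l \<in> A. letter l \<in> functionals R Z}"
    using l \<phi> by (auto simp: w_def)
  ultimately show ?thesis by blast
qed

text \<open>The map \<open>T\<close> copies coordinates: coordinate \<open>i\<close> of \<open>T v\<close> is coordinate \<open>s ! i\<close> of \<open>v\<close>. One and the same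
  \<open>T\<close> serves all words, which is what makes it possible to compare their images.\<close>

lemma coordinate_substitution:
  assumes X: "coordinates R X d x coord" and Y: "coordinates R Y (length s) y coord'"
    and s: "set s \<subseteq> {..<d}"
  shows "\<exists>T \<in> module_hom R X Y \<inter> extensional (carrier X). \<forall>Z letter w. module R Z \<longrightarrow> length w = d \<longrightarrow>
    (\<forall>l\<in>set w. letter l \<in> functionals R Z) \<longrightarrow>
    compose (carrier Z) T (coordinates.word_map X d x letter Z w) =
      coordinates.word_map Y (length s) y letter Z (map ((!) w) s)"
proof -
  interpret X: coordinates R X d x coord by (rule X)
  interpret Y: coordinates R Y "length s" y coord' by (rule Y)
  have s_nth: "s ! i < d" if "i < length s" for i using s that by (auto simp: subset_iff)
  have closed: "(\<lambda>i. coord v (s ! i)) \<in> {..<length s} \<rightarrow> carrier R" if "v \<in> carrier X" for v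
    using X.coord_closed that s_nth by auto
  define T where "T = (\<lambda>v\<in>carrier X. Y.combination (\<lambda>i. coord v (s ! i)))"
  have add: "Y.combination (\<lambda>i. coord (u \<oplus>\<^bsub>X\<^esub> v) (s ! i)) =
      Y.combination (\<lambda>i. coord u (s ! i)) \<oplus>\<^bsub>Y\<^esub> Y.combination (\<lambda>i. coord v (s ! i))"
    if uv: "u \<in> carrier X" "v \<in> carrier X" for u v
  proof -
    have "Y.combination (\<lambda>i. coord (u \<oplus>\<^bsub>X\<^esub> v) (s ! i)) =
        Y.combination (\<lambda>i. coord u (s ! i) \<oplus>\<^bsub>R\<^esub> coord v (s ! i))"
      using uv s_nth X.coord_closed by (intro Y.combination_cong) (auto simp: X.coord_add)
    then show ?thesis using closed uv by (simp add: Y.combination_add)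
  qed
  have smult: "Y.combination (\<lambda>i. coord (r \<odot>\<^bsub>X\<^esub> v) (s ! i)) =
      r \<odot>\<^bsub>Y\<^esub> Y.combination (\<lambda>i. coord v (s ! i))" if rv: "r \<in> carrier R" "v \<in> carrier X" for r v
  proof -
    have "Y.combination (\<lambda>i. coord (r \<odot>\<^bsub>X\<^esub> v) (s ! i)) =
        Y.combination (\<lambda>i. r \<otimes>\<^bsub>R\<^esub> coord v (s ! i))"
      using rv s_nth X.coord_closed by (intro Y.combination_cong) (auto simp: X.coord_smult)
    then show ?thesis using closed rv by (simp add: Y.combination_smult)
  qed
  have T: "T \<in> module_hom R X Y \<inter> extensional (carrier X)"
    using Y.combination_closed[OF closed] add smult by (auto simp: T_def module_hom_def)
  have "compose (carrier Z) T (X.word_map letter Z w) = Y.word_map letter Z (map ((!) w) s)"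
    if "module R Z" "length w = d" "\<forall>l\<in>set w. letter l \<in> functionals R Z" for Z letter w
  proof (rule extensionalityI[of _ "carrier Z"])
    show "compose (carrier Z) T (X.word_map letter Z w) \<in> extensional (carrier Z)" by simp
    show "Y.word_map letter Z (map ((!) w) s) \<in> extensional (carrier Z)" by (simp add: Y.word_map_def)
    fix z assume z: "z \<in> carrier Z"
    have fl: "(\<lambda>i. letter (w ! i) z) \<in> {..<d} \<rightarrow> carrier R"
      using X.letters_closed[of w letter Z z] that z by blast
    have "Y.combination (\<lambda>i. coord (X.combination (\<lambda>i. letter (w ! i) z)) (s ! i)) =
        Y.combination (\<lambda>i. letter (map ((!) w) s ! i) z)"
      using fl s_nth by (intro Y.combination_cong) (auto simp: X.coord_combination)
    then show "compose (carrier Z) T (X.word_map letter Z w) z = Y.word_map letter Z (map ((!) w) s) z"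
      using z X.combination_closed[OF fl]
      by (simp add: compose_def T_def X.word_map_def Y.word_map_def)
  qed
  with T show ?thesis by blast
qed

section \<open>Noetherianity\<close>

theorem theorem3:
  fixes R :: "'r ring"
  assumes "cring R" and "finite (carrier R)"
    and "infinite (UNIV :: 'm set)"
  shows "locally_noetherian TYPE('k) TYPE('v) (V' R :: (('r, 'm) module, 'm \<Rightarrow> 'm) category)"
  unfolding locally_noetherian_def locally_noetherian_over_def
proof (intro allI impI, elim conjE)
  fix k :: "'k ring" and N
    and M :: "(('r, 'm) module, 'm \<Rightarrow> 'm, 'k, 'v) cmodule"
  assume k: "noetherian_ring k" and M: "cmodule (V' R) k M"
    and fg: "fin_generated (V' R) k M" and N: "csubmodule (V' R) k M N"
  let ?C = "V' R :: (('r, 'm) module, 'm \<Rightarrow> 'm) category"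
  have Obj: "X \<in> Obj ?C \<longleftrightarrow> free_of_finite_rank R X" for X
    by (simp add: V'_def module_cat_def)
  have Hom: "Hom ?C X Y = module_hom R X Y \<inter> extensional (carrier X)" for X Y
    by (simp add: V'_def module_cat_def)
  have module_Obj: "module R X" if "X \<in> Obj ?C" for X
    using that by (simp add: Obj free_of_finite_rank_def)
  have act_comp: "on_Hom M X Y f (on_Hom M Z X g z) = on_Hom M Z Y (compose (carrier Z) f g) z"
    if "Z \<in> Obj ?C" "X \<in> Obj ?C" "Y \<in> Obj ?C" "g \<in> Hom ?C Z X" "f \<in> Hom ?C X Y"
      "z \<in> carrier (on_Obj M Z)" for X Y Z f g z
  proof -
    have "on_Hom M Z Y (Comp ?C Z X Y f g) =
        Comp (module_cat k) (on_Obj M Z) (on_Obj M X) (on_Obj M Y) (on_Hom M X Y f) (on_Hom M Z X g)"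
      using M that(1-5) unfolding cmodule_def by (intro cat_functor.on_Hom_Comp)
    then show ?thesis using that(6) by (simp add: V'_def module_cat_def compose_def)
  qed
  obtain S where S: "finite S" "\<And>Z z. (Z, z) \<in> S \<Longrightarrow> Z \<in> Obj ?C \<and> z \<in> carrier (on_Obj M Z)"
      "\<And>X. X \<in> Obj ?C \<Longrightarrow> generated_csubmodule ?C k M S X = carrier (on_Obj M X)"
    using fg unfolding fin_generated_def by blast
  obtain gs where gs: "set gs = S" using finite_list[OF S(1)] by blast
  define Z z where "Z i = fst (gs ! i)" and "z i = snd (gs ! i)" for i
  define p where "p = length gs"
  have gen: "Z i \<in> Obj ?C" "z i \<in> carrier (on_Obj M (Z i))" if "i < p" for i
    using S(2)[of "Z i" "z i"] that gs nth_mem[of i gs] by (auto simp: Z_def z_def p_def)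
  have "\<exists>d x coord. X \<in> Obj ?C \<longrightarrow> coordinates R X d x coord" for X
    using free_coordinates by (auto simp: Obj)
  then obtain d x coord where coords: "\<And>X. X \<in> Obj ?C \<Longrightarrow> coordinates R X (d X) (x X) (coord X)"
    by metis
  \<comment> \<open>Letters are numbered to have a linear order on words; one alphabet serves all generators.\<close>
  define \<Phi> where "\<Phi> = (\<Union>i<p. functionals R (Z i))"
  have "finite \<Phi>"
    unfolding \<Phi>_def using gen(1) coordinates.finite_carrier[OF coords assms(2)]
    by (auto intro: finite_functionals[OF assms(2)])
  then obtain K and letter :: "nat \<Rightarrow> 'm \<Rightarrow> 'r" where letter: "\<Phi> = letter ` {..<K}"
    using ex_bij_betw_nat_finite[of \<Phi>] by (metis atLeast0LessThan bij_betw_imp_surj_on)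
  define alphabet where "alphabet i = {l \<in> {..<K}. letter l \<in> functionals R (Z i)}" for i
  define word_map where "word_map X = coordinates.word_map X (d X) (x X) letter" for X
  define B where "B X = {m. fst m < p \<and> length (snd m) = d X \<and> set (snd m) \<subseteq> alphabet (fst m)}" for X
  define b where "b X m = on_Hom M (Z (fst m)) X (word_map X (Z (fst m)) (snd m)) (z (fst m))"
    for X and m :: "nat \<times> nat list"
  define le where "le m m' \<longleftrightarrow> fst m = fst m' \<and> pulls_back_to (snd m) (snd m')"
    for m m' :: "nat \<times> nat list"
  have word_map_Hom: "word_map X (Z (fst m)) (snd m) \<in> Hom ?C (Z (fst m)) X"
    if "X \<in> Obj ?C" "m \<in> B X" for X m
    unfolding Hom word_map_def
    by (rule coordinates.word_map_hom[OF coords[OF that(1)] module_Obj[OF gen(1)]])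
      (use that in \<open>auto simp: B_def alphabet_def\<close>)
  have b_closed: "b X ` B X \<subseteq> carrier (on_Obj M X)" if "X \<in> Obj ?C" for X
  proof (rule image_subsetI)
    fix m assume m: "m \<in> B X"
    then have "fst m < p" by (simp add: B_def)
    then show "b X m \<in> carrier (on_Obj M X)"
      unfolding b_def using cmodule_hom[OF M gen(1) that word_map_Hom[OF that m]] gen(2)
      by (auto dest: module_hom_closed)
  qed
  have Hom_word: "\<exists>m\<in>B X. on_Hom M (Z i) X g (z i) = b X m"
    if X: "X \<in> Obj ?C" and i: "i < p" and g: "g \<in> Hom ?C (Z i) X" for X i g
  proof -
    have "functionals R (Z i) \<subseteq> letter ` {..<K}"
      using i letter unfolding \<Phi>_def by blast
    then obtain w where "length w = d X" "set w \<subseteq> alphabet i" "g = word_map X (Z i) w"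
      using coordinates.hom_is_word_map[OF coords[OF X] module_Obj[OF gen(1)[OF i]]] g
      unfolding Hom alphabet_def word_map_def by blast
    then show ?thesis
      using i by (intro bexI[of _ "(i, w)"]) (auto simp: B_def b_def)
  qed
  show "fin_generated ?C k (sub_cmodule M N)"
  proof (rule fin_generated_of_Groebner_order[of k ?C M N B b le])
    show "finite (B X)" for X
    proof (rule finite_subset)
      show "B X \<subseteq> {..<p} \<times> {w. set w \<subseteq> {..<K} \<and> length w = d X}"
        by (auto simp: B_def alphabet_def)
      show "finite ({..<p} \<times> {w. set w \<subseteq> {..<K} \<and> length w = d X})"
        by (intro finite_cartesian_product finite_lists_length_eq) auto
    qed
    show "b X ` B X \<subseteq> carrier (on_Obj M X)" if "X \<in> Obj ?C" for X
      by (rule b_closed[OF that])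
    \<comment> \<open>The spans of the monomials form a submodule that contains the generators, hence are everything.\<close>
    define H where "H X = module.span k (on_Obj M X) (b X ` B X)" for X
    have in_H: "b X m \<in> H X" if "X \<in> Obj ?C" "m \<in> B X" for X m
      using module.in_own_span[OF cmodule_module[OF M that(1)] b_closed[OF that(1)]] that(2)
      unfolding H_def by blast
    have H: "csubmodule ?C k M H"
      unfolding csubmodule_def
    proof (intro conjI ballI)
      show "Module.submodule (H X) k (on_Obj M X)" if "X \<in> Obj ?C" for X
        unfolding H_def
        by (rule module.submodule_span[OF cmodule_module[OF M that] b_closed[OF that]])
      show "on_Hom M X Y f ` H X \<subseteq> H Y"
        if X: "X \<in> Obj ?C" and Y: "Y \<in> Obj ?C" and f: "f \<in> Hom ?C X Y" for X Y f
        unfolding H_def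
      proof (rule module_hom_span[OF cmodule_module[OF M X] cmodule_module[OF M Y]
            cmodule_hom[OF M X Y f] b_closed[OF X] b_closed[OF Y]], rule image_subsetI, elim imageE)
        fix v m assume v: "v = b X m" and m: "m \<in> B X"
        then have i: "fst m < p" by (simp add: B_def)
        note g = word_map_Hom[OF X m]
        have "on_Hom M X Y f v =
            on_Hom M (Z (fst m)) Y (compose (carrier (Z (fst m))) f (word_map X (Z (fst m)) (snd m))) (z (fst m))"
          unfolding v b_def by (rule act_comp[OF gen(1)[OF i] X Y g f gen(2)[OF i]])
        moreover have "compose (carrier (Z (fst m))) f (word_map X (Z (fst m)) (snd m)) \<in> Hom ?C (Z (fst m)) Y"
          using module_hom_comp[OF _ _ module_Obj[OF gen(1)[OF i]]] g f unfolding Hom by auto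
        ultimately obtain m' where "m' \<in> B Y" "on_Hom M X Y f v = b Y m'"
          using Hom_word[OF Y i] by metis
        then show "on_Hom M X Y f v \<in> module.span k (on_Obj M Y) (b Y ` B Y)"
          using in_H[OF Y] unfolding H_def by simp
      qed
    qed
    have "v \<in> H Y" if v: "(Y, v) \<in> S" for Y v
    proof -
      obtain i where i: "i < p" "gs ! i = (Y, v)"
        using v gs by (auto simp: in_set_conv_nth p_def)
      then have Zi: "Z i = Y" "z i = v" by (auto simp: Z_def z_def)
      have Y: "Y \<in> Obj ?C" using gen(1)[OF i(1)] Zi by simp
      have id: "Ident ?C Y \<in> Hom ?C Y Y" by (rule category.Ident_in_Hom[OF category_V' Y])
      have "on_Hom M Y Y (Ident ?C Y) = Ident (module_cat k) (on_Obj M Y)"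
        using M Y unfolding cmodule_def by (rule cat_functor.on_Hom_Ident)
      then have "on_Hom M Y Y (Ident ?C Y) v = v"
        using S(2)[OF v] by (simp add: module_cat_def)
      then show ?thesis
        using Hom_word[OF Y i(1)] id Zi in_H[OF Y] by metis
    qed
    then show "carrier (on_Obj M X) \<subseteq> module.span k (on_Obj M X) (b X ` B X)" if "X \<in> Obj ?C" for X
      using S(3)[OF that] H unfolding generated_csubmodule_def H_def[symmetric] by blast
    show "\<exists>i j. i < j \<and> le (f i) (f j)" if f: "range f \<subseteq> (\<Union>X\<in>Obj ?C. B X)" for f :: "nat \<Rightarrow> nat \<times> nat list"
      unfolding le_def
    proof (rule pulls_back_to_almost_full)
      show "fst (f n) \<in> {..<p} \<and> set (snd (f n)) \<subseteq> {..<K}" for n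
      proof -
        have "f n \<in> (\<Union>X\<in>Obj ?C. B X)" using f by blast
        then show ?thesis by (auto simp: B_def alphabet_def)
      qed
    qed auto
    fix X Y and m m' :: "nat \<times> nat list"
    assume X: "X \<in> Obj ?C" and Y: "Y \<in> Obj ?C" and m: "m \<in> B X" and m': "m' \<in> B Y" and "le m m'"
    then obtain s where fst: "fst m = fst m'" and s: "set s \<subseteq> {..<length (snd m)}"
        "snd m' = map ((!) (snd m)) s"
        "\<And>v. length v = length (snd m) \<Longrightarrow> v < snd m \<Longrightarrow> map ((!) v) s < snd m'"
      unfolding le_def pulls_back_to_def by auto
    have len: "length s = d Y" "length (snd m) = d X" using s(2) m m' by (auto simp: B_def)
    obtain T where T: "T \<in> Hom ?C X Y" and subst: "\<And>(Z :: ('r, 'm) module) (letter :: nat \<Rightarrow> 'm \<Rightarrow> 'r) w. module R Z \<Longrightarrow> length w = d X \<Longrightarrow>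
        (\<forall>l\<in>set w. letter l \<in> functionals R Z) \<Longrightarrow>
        compose (carrier Z) T (coordinates.word_map X (d X) (x X) letter Z w) =
          coordinates.word_map Y (d Y) (x Y) letter Z (map ((!) w) s)"
      using coordinate_substitution[OF coords[OF X], of Y s "x Y" "coord Y"] coords[OF Y] s(1)
      unfolding Hom len by metis
    have T_b: "on_Hom M X Y T (b X n) = b Y (fst n, map ((!) (snd n)) s)" if n: "n \<in> B X" for n
    proof -
      have i: "fst n < p" using n by (simp add: B_def)
      have "compose (carrier (Z (fst n))) T (word_map X (Z (fst n)) (snd n)) =
          word_map Y (Z (fst n)) (map ((!) (snd n)) s)"
        unfolding word_map_def
        using n by (intro subst module_Obj gen(1) i) (auto simp: B_def alphabet_def)
      then show ?thesis
        unfolding b_def using act_comp[OF gen(1)[OF i] X Y word_map_Hom[OF X n] T gen(2)[OF i]] by simp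
    qed
    show "\<exists>f\<in>Hom ?C X Y. on_Hom M X Y f (b X m) = b Y m' \<and>
        (\<forall>n\<in>B X. n < m \<longrightarrow> on_Hom M X Y f (b X n) \<in> b Y ` {n' \<in> B Y. n' < m'})"
    proof (intro bexI[OF _ T] conjI ballI impI)
      show "on_Hom M X Y T (b X m) = b Y m'"
        unfolding T_b[OF m] using fst s(2) by (metis prod.collapse)
      fix n assume n: "n \<in> B X" and "n < m"
      let ?n' = "(fst n, map ((!) (snd n)) s)"
      have "length (snd n) = length (snd m)" using n len by (simp add: B_def)
      then have "set (map ((!) (snd n)) s) \<subseteq> set (snd n)"
        using s(1) by auto
      then have "?n' \<in> B Y" using n len by (auto simp: B_def)
      moreover have "?n' < m'"
        using \<open>n < m\<close> fst s(3)[OF \<open>length (snd n) = length (snd m)\<close>]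
        by (auto simp: less_prod_def')
      ultimately show "on_Hom M X Y T (b X n) \<in> b Y ` {n' \<in> B Y. n' < m'}"
        unfolding T_b[OF n] by blast
    qed
  qed (use k M N in auto)
qed

end
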